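(* Let $\langle a,b,c\rangle$ be the free group of rank $3$ on $a,b,c$, and for $i\in\mathbb Z$ let $b_i=c^{-i}bc^i$. For any integer $m$, each of the subgroups $$\langle b_m,b_{m+1},\ldots\rangle,\quad \langle a,b_m,b_{m+1},\ldots\rangle,\quad \langle b_{m-1},b_{m-2},\ldots\rangle,\quad \langle a,b_{m-1},b_{m-2},\ldots\rangle$$ is benign in $\langle a,b,c\rangle$.
   Context: A subgroup $H$ of a finitely generated group $G$ is called benign in $G$ if $G$ can be embedded in a finitely presented group $K$ with a finitely generated subgroup $L\le K$ such that $G\cap L=H$. The set $b_m,b_{m+1},\ldots$ consists of all $b_i$ with $i\ge m$, and $b_{m-1},b_{m-2},\ldots$ of all $b_i$ with $i\le m-1$. *)

theory Defs
  imports "HOL-Algebra.Generated_Groups"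
begin

section \<open>Free groups\<close>

text \<open>
  The free group on a set \<open>X\<close> is the group of reduced words. A letter \<open>(x, True)\<close> stands for
  \<open>x\<close> and \<open>(x, False)\<close> for its inverse.
\<close>

type_synonym 'x letter = "'x \<times> bool"

type_synonym 'x word = "'x letter list"

definition inv_letter :: "'x letter \<Rightarrow> 'x letter" where
  "inv_letter p = (fst p, \<not> snd p)"

definition reduced :: "'x word \<Rightarrow> bool" where
  "reduced = successively (\<lambda>p q. q \<noteq> inv_letter p)"

fun push :: "'x letter \<Rightarrow> 'x word \<Rightarrow> 'x word" where
  "push p [] = [p]"
| "push p (q # w) = (if q = inv_letter p then w else p # q # w)"

text \<open>If \<open>v\<close> is reduced, then \<open>foldr push u v\<close> is the reduced form of the concatenation \<open>u @ v\<close>.\<close>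

definition free_group :: "'x set \<Rightarrow> 'x word monoid" where
  "free_group X =
     \<lparr>carrier = {w. reduced w \<and> fst ` set w \<subseteq> X}, mult = (\<lambda>u v. foldr push u v), one = []\<rparr>"

definition free_gen :: "'x \<Rightarrow> 'x word" where
  "free_gen x = [(x, True)]"

definition word_inv :: "'x word \<Rightarrow> 'x word" where
  "word_inv w = rev (map inv_letter w)"

lemma inv_letter_inv_letter [simp]: "inv_letter (inv_letter p) = p"
  by (simp add: inv_letter_def)

lemma fst_inv_letter [simp]: "fst (inv_letter p) = fst p"
  by (simp add: inv_letter_def)

lemma reduced_Nil [simp]: "reduced []"
  by (simp add: reduced_def)

lemma reduced_Cons: "reduced (p # w) \<longleftrightarrow> w = [] \<or> hd w \<noteq> inv_letter p \<and> reduced w"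
  by (auto simp: reduced_def successively_Cons)

lemma reduced_push: "reduced w \<Longrightarrow> reduced (push p w)"
  by (cases w) (auto simp: reduced_Cons)

lemma reduced_foldr_push: "reduced w \<Longrightarrow> reduced (foldr push u w)"
  by (induction u) (auto simp: reduced_push)

lemma push_eq_Cons: "reduced (p # w) \<Longrightarrow> push p w = p # w"
  by (cases w) (auto simp: reduced_Cons)

lemma push_push_inv: "reduced w \<Longrightarrow> push p (push (inv_letter p) w) = w"
  by (cases w) (auto simp: push_eq_Cons)

lemma push_inv_push: "reduced w \<Longrightarrow> push (inv_letter p) (push p w) = w"
  using push_push_inv[of w "inv_letter p"] by simp

lemma foldr_push_push:
  assumes "reduced v" "reduced w"
  shows "foldr push (push p v) w = push p (foldr push v w)"
proof (cases v)
  case (Cons q v')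
  then show ?thesis
    using assms by (auto simp: push_push_inv reduced_foldr_push)
qed simp

lemma foldr_push_assoc:
  assumes "reduced v" "reduced w"
  shows "foldr push (foldr push u v) w = foldr push u (foldr push v w)"
  using assms by (induction u) (auto simp: foldr_push_push reduced_foldr_push)

lemma foldr_push_Nil: "reduced w \<Longrightarrow> foldr push w [] = w"
  by (induction w) (auto simp: push_eq_Cons reduced_Cons)

lemma set_push: "set (push p w) \<subseteq> insert p (set w)"
  by (cases w) auto

lemma set_foldr_push: "set (foldr push u w) \<subseteq> set u \<union> set w"
  by (induction u) (use set_push in fastforce)+

lemma reduced_word_inv: "reduced w \<Longrightarrow> reduced (word_inv w)"
  unfolding reduced_def word_inv_def successively_rev successively_map
  by (erule successively_mono) (metis inv_letter_inv_letter)

lemma foldr_push_word_inv: "reduced v \<Longrightarrow> foldr push (word_inv u) (foldr push u v) = v"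
  by (induction u) (auto simp: word_inv_def push_inv_push reduced_foldr_push)

lemma group_free_group: "group (free_group X)"
proof (rule groupI)
  fix u v assume "u \<in> carrier (free_group X)" "v \<in> carrier (free_group X)"
  then show "u \<otimes>\<^bsub>free_group X\<^esub> v \<in> carrier (free_group X)"
    using set_foldr_push[of u v] by (force simp: free_group_def reduced_foldr_push)
next
  fix u assume u: "u \<in> carrier (free_group X)"
  have "word_inv u \<in> carrier (free_group X)"
    using u by (auto simp: free_group_def reduced_word_inv)
      (auto simp: word_inv_def inv_letter_def)
  moreover have "word_inv u \<otimes>\<^bsub>free_group X\<^esub> u = \<one>\<^bsub>free_group X\<^esub>"
    using u foldr_push_word_inv[of "[]" u] by (simp add: free_group_def foldr_push_Nil)
  ultimately show "\<exists>v\<in>carrier (free_group X). v \<otimes>\<^bsub>free_group X\<^esub> u = \<one>\<^bsub>free_group X\<^esub>"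
    by blast
qed (auto simp: free_group_def foldr_push_assoc)

lemma free_gen_closed: "x \<in> X \<Longrightarrow> free_gen x \<in> carrier (free_group X)"
  by (simp add: free_gen_def free_group_def reduced_Cons)


section \<open>Finitely presented groups\<close>

definition normal_closure :: "('a, 'm) monoid_scheme \<Rightarrow> 'a set \<Rightarrow> 'a set" where
  "normal_closure G R =
     generate G (\<Union>r\<in>R. (\<lambda>g. g \<otimes>\<^bsub>G\<^esub> r \<otimes>\<^bsub>G\<^esub> inv\<^bsub>G\<^esub> g) ` carrier G)"

lemma (in group) normal_normal_closure:
  assumes "R \<subseteq> carrier G"
  shows "normal_closure G R \<lhd> G"
  unfolding normal_closure_def
proof (rule normal_generateI)
  fix h g
  assume "h \<in> (\<Union>r\<in>R. (\<lambda>g. g \<otimes> r \<otimes> inv g) ` carrier G)" and g: "g \<in> carrier G"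
  then obtain r k where r: "r \<in> R" and k: "k \<in> carrier G" and h: "h = k \<otimes> r \<otimes> inv k"
    by auto
  have "g \<otimes> h \<otimes> inv g = (g \<otimes> k) \<otimes> r \<otimes> inv (g \<otimes> k)"
    using r k g assms h by (simp add: m_assoc inv_mult_group subset_iff)
  then show "g \<otimes> h \<otimes> inv g \<in> (\<Union>r\<in>R. (\<lambda>g. g \<otimes> r \<otimes> inv g) ` carrier G)"
    using r k g by blast
qed (use assms in auto)

definition presented_group :: "'x set \<Rightarrow> 'x word set \<Rightarrow> 'x word set monoid" where
  "presented_group X R = free_group X Mod normal_closure (free_group X) R"

lemma group_presented_group:
  "R \<subseteq> carrier (free_group X) \<Longrightarrow> group (presented_group X R)"
  unfolding presented_group_def
  by (intro normal.factorgroup_is_group group.normal_normal_closure group_free_group)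

text \<open>Since only finitely many generators are involved, they may be named by natural numbers.\<close>

definition finitely_presented :: "('a, 'm) monoid_scheme \<Rightarrow> bool" where
  "finitely_presented G \<longleftrightarrow> group G \<and>
     (\<exists>(X :: nat set) R. finite X \<and> finite R \<and> R \<subseteq> carrier (free_group X) \<and>
        G \<cong> presented_group X R)"


section \<open>Benign subgroups\<close>

definition fin_gen_subgroup :: "'a set \<Rightarrow> ('a, 'm) monoid_scheme \<Rightarrow> bool" where
  "fin_gen_subgroup L G \<longleftrightarrow> (\<exists>S. finite S \<and> S \<subseteq> carrier G \<and> L = generate G S)"

definition finitely_generated :: "('a, 'm) monoid_scheme \<Rightarrow> bool" where
  "finitely_generated G \<longleftrightarrow> group G \<and> fin_gen_subgroup (carrier G) G"

text \<open>
  HOL cannot quantify over the type of the overgroup \<open>K\<close>. It is fixed here to a type on which every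
  finitely presented group has an isomorphic copy, so no overgroup is lost; the lemma \<open>benignI\<close>
  below admits overgroups of any type.
\<close>

definition benign :: "'a set \<Rightarrow> ('a, 'm) monoid_scheme \<Rightarrow> bool" where
  "benign H G \<longleftrightarrow> finitely_generated G \<and> subgroup H G \<and>
     (\<exists>(K :: nat word set monoid) \<phi> L.
        finitely_presented K \<and> \<phi> \<in> mon G K \<and> fin_gen_subgroup L K \<and>
        \<phi> ` carrier G \<inter> L = \<phi> ` H)"

lemma benignI:
  fixes K :: "('k, 'n) monoid_scheme"
  assumes G: "finitely_generated G" and H: "subgroup H G"
    and K: "finitely_presented K" and \<phi>: "\<phi> \<in> mon G K" and L: "fin_gen_subgroup L K"
    and eq: "\<phi> ` carrier G \<inter> L = \<phi> ` H"
  shows "benign H G"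
proof -
  from K obtain X :: "nat set" and R where XR: "finite X" "finite R" "R \<subseteq> carrier (free_group X)"
    and "K \<cong> presented_group X R" and gK: "group K"
    by (auto simp: finitely_presented_def)
  then obtain h where h: "h \<in> iso K (presented_group X R)"
    by (auto simp: is_iso_def)
  define P where "P = presented_group X R"
  have gP: "group P"
    using XR by (simp add: P_def group_presented_group)
  have h_hom: "h \<in> hom K P" and h_inj: "inj_on h (carrier K)" and h_img: "h ` carrier K = carrier P"
    using h by (auto simp: iso_def bij_betw_def P_def)
  interpret h: group_hom K P h
    using gK gP h_hom by (simp add: group_hom_def group_hom_axioms_def)
  have "finitely_presented P"
    using XR gP iso_refl[of P] unfolding finitely_presented_def P_def by blast
  moreover have \<phi>_img: "\<phi> ` carrier G \<subseteq> carrier K"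
    using \<phi> by (auto simp: mon_def hom_def)
  then have "h \<circ> \<phi> \<in> mon G P"
    using \<phi> h_hom h_inj hom_compose[of \<phi> G K h P]
    by (auto simp: mon_def intro!: comp_inj_on elim: inj_on_subset)
  moreover obtain S where S: "finite S" "S \<subseteq> carrier K" "L = generate K S"
    using L by (auto simp: fin_gen_subgroup_def)
  then have "h ` L = generate P (h ` S)" "h ` S \<subseteq> carrier P"
    using h.generate_img h_img by auto
  then have "fin_gen_subgroup (h ` L) P"
    using S by (auto simp: fin_gen_subgroup_def)
  moreover have "L \<subseteq> carrier K"
    using S h.G.generate_incl by simp
  then have "(h \<circ> \<phi>) ` carrier G \<inter> h ` L = (h \<circ> \<phi>) ` H"
    using inj_on_image_Int[OF h_inj \<phi>_img, of L] eq unfolding image_comp[symmetric] by simp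
  ultimately show ?thesis
    using G H unfolding benign_def by blast
qed

end

theory Submission
  imports Defs "HOL-Algebra.Bij" "HOL-Library.Countable_Set"
begin

text \<open>
  Consider the endomorphisms \<open>\<tau>\<^sub>0\<close> and \<open>\<tau>\<^sub>1\<close> of the free group \<open>F\<close> on \<open>a, b, c\<close> that fix \<open>a\<close>, square
  \<open>c\<close>, and send \<open>b\<close> to the conjugate \<open>b\<^sub>k\<close> with \<open>k = -m\<close> and \<open>k = 1 - m\<close>, respectively. Then \<open>b\<^sub>i\<close> goes
  to the conjugate with index \<open>2 i - m\<close> or \<open>2 i - m + 1\<close>. In terms of \<open>n = i - m\<close> these maps are
  \<open>n \<mapsto> 2 n\<close> and \<open>n \<mapsto> 2 n + 1\<close>: they preserve and reflect each of the half-lines \<open>n \<ge> 0\<close> and \<open>n < 0\<close>,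
  and they generate the first from \<open>0\<close> and the second from \<open>-1\<close>. Hence each of the four subgroups \<open>H\<close>
  is the least one that contains a set \<open>T\<close> of at most two elements and is closed under \<open>\<tau>\<^sub>0\<close> and
  \<open>\<tau>\<^sub>1\<close>, and \<open>H\<close> is its own inverse image under both of them.

  This makes \<open>H\<close> benign (\<open>benign_free_group_by_endomorphisms\<close>). Adjoin to \<open>F\<close> stable letters \<open>s\<^sub>0, s\<^sub>1\<close>
  with \<open>s\<^sub>j g s\<^sub>j\<inverse> = \<tau>\<^sub>j(g)\<close> to get a finitely presented group \<open>K\<close>, and let \<open>L\<close> be generated by \<open>T, s\<^sub>0, s\<^sub>1\<close>.
  As conjugation by \<open>s\<^sub>j\<close> maps \<open>F \<inter> L\<close> into itself, \<open>F \<inter> L\<close> is closed under \<open>\<tau>\<^sub>j\<close>, so \<open>H \<subseteq> L\<close>.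
  That \<open>F\<close> embeds into \<open>K\<close> and \<open>F \<inter> L \<subseteq> H\<close> is seen in an action of \<open>K\<close> on infinitely
  many copies of \<open>F\<close> that extends left translation: the permutations for \<open>s\<^sub>0\<close> and \<open>s\<^sub>1\<close>
  can be chosen to preserve a set that consists of one copy of \<open>H\<close> in each of infinitely many copies
  of \<open>F\<close> and misses infinitely many others (\<open>conjugating_permutation\<close>).

  It remains to show that the \<open>\<tau>\<^sub>j\<close> are injective and reflect membership in \<open>H\<close>. Membership of a reduced
  word is tested by following the exponent sum of \<open>c\<close> along it (\<open>mem_span_iff_supported\<close>), and
  up to an automorphism \<open>\<tau>\<^sub>j\<close> just doubles every letter \<open>c\<close>, which keeps words reduced and doubles the
  exponent sums (\<open>dilate_mem_span_iff\<close>).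
\<close>

section \<open>The universal property of free groups\<close>

lemma free_group_simps [simp]:
  "u \<otimes>\<^bsub>free_group X\<^esub> v = foldr push u v"
  "\<one>\<^bsub>free_group X\<^esub> = []"
  by (simp_all add: free_group_def)

lemma Cons_carrier_free_group:
  assumes "p # w \<in> carrier (free_group X)"
  shows "fst p \<in> X" "w \<in> carrier (free_group X)" "foldr push [p] w = p # w"
  using assms by (auto simp: free_group_def reduced_Cons push_eq_Cons)

lemma letter_carrier: "fst p \<in> X \<Longrightarrow> [p] \<in> carrier (free_group X)"
  by (simp add: free_group_def reduced_Cons)

lemma inv_letter_word:
  assumes "fst p \<in> X"
  shows "inv\<^bsub>free_group X\<^esub> [p] = [inv_letter p]"
proof -
  interpret group "free_group X" by (rule group_free_group)
  show ?thesis
    by (rule inv_equality) (use assms in \<open>auto simp: letter_carrier\<close>)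
qed

definition letter_value :: "('a, 'm) monoid_scheme \<Rightarrow> ('x \<Rightarrow> 'a) \<Rightarrow> 'x letter \<Rightarrow> 'a" where
  "letter_value G f p = (if snd p then f (fst p) else inv\<^bsub>G\<^esub> f (fst p))"

text \<open>
  Defined on all words over \<open>X\<close>, reduced or not: the cancellation step \<open>push\<close> does not change the
  value, and this is what makes \<open>lift G f\<close> a homomorphism.
\<close>

definition lift :: "('a, 'm) monoid_scheme \<Rightarrow> ('x \<Rightarrow> 'a) \<Rightarrow> 'x word \<Rightarrow> 'a" where
  "lift G f w = foldr (\<lambda>p g. letter_value G f p \<otimes>\<^bsub>G\<^esub> g) w \<one>\<^bsub>G\<^esub>"

context group
begin

lemma letter_value_closed: "f \<in> X \<rightarrow> carrier G \<Longrightarrow> fst p \<in> X \<Longrightarrow> letter_value G f p \<in> carrier G"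
  by (auto simp: letter_value_def)

lemma letter_value_inv_letter:
  "f \<in> X \<rightarrow> carrier G \<Longrightarrow> fst p \<in> X \<Longrightarrow> letter_value G f (inv_letter p) = inv (letter_value G f p)"
  by (auto simp: letter_value_def inv_letter_def Pi_iff)

lemma lift_closed:
  "f \<in> X \<rightarrow> carrier G \<Longrightarrow> fst ` set w \<subseteq> X \<Longrightarrow> lift G f w \<in> carrier G"
  by (induction w) (auto simp: lift_def letter_value_closed)

lemma lift_push:
  assumes "f \<in> X \<rightarrow> carrier G" "fst p \<in> X" "fst ` set w \<subseteq> X"
  shows "lift G f (push p w) = letter_value G f p \<otimes> lift G f w"
proof (cases w)
  case (Cons q w')
  have "letter_value G f p \<in> carrier G" "lift G f w' \<in> carrier G"
    using assms Cons by (auto simp: letter_value_closed lift_closed)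
  moreover have "letter_value G f q = inv (letter_value G f p)" if "q = inv_letter p"
    using assms that by (simp add: letter_value_inv_letter)
  ultimately show ?thesis
    using Cons by (auto simp: lift_def m_assoc[symmetric])
qed (simp add: lift_def)

lemma lift_hom:
  assumes f: "f \<in> X \<rightarrow> carrier G"
  shows "lift G f \<in> hom (free_group X) G"
proof (rule homI)
  fix u v assume "u \<in> carrier (free_group X)" "v \<in> carrier (free_group X)"
  then have "fst ` set u \<subseteq> X" "fst ` set v \<subseteq> X"
    by (auto simp: free_group_def)
  then show "lift G f (u \<otimes>\<^bsub>free_group X\<^esub> v) = lift G f u \<otimes> lift G f v"
  proof (induction u)
    case Nil
    then show ?case
      using f by (simp add: lift_closed) (simp add: lift_def)
  next
    case (Cons p u)
    have "fst ` set (foldr push u v) \<subseteq> fst ` set u \<union> fst ` set v"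
      using image_mono[OF set_foldr_push[of u v], of fst] by (simp add: image_Un)
    also have "\<dots> \<subseteq> X" using Cons.prems by simp
    finally have "fst ` set (foldr push u v) \<subseteq> X" .
    then have "lift G f (foldr push (p # u) v) = letter_value G f p \<otimes> lift G f (foldr push u v)"
      using Cons.prems lift_push[OF f] by simp
    also have "\<dots> = letter_value G f p \<otimes> lift G f u \<otimes> lift G f v"
      using Cons f by (simp add: m_assoc letter_value_closed lift_closed)
    finally show ?case
      by (simp add: lift_def)
  qed
qed (use f in \<open>auto simp: free_group_def lift_closed\<close>)

lemma lift_group_hom: "f \<in> X \<rightarrow> carrier G \<Longrightarrow> group_hom (free_group X) G (lift G f)"
  by (simp add: group_hom_def group_hom_axioms_def group_free_group lift_hom)

lemma lift_free_gen: "f x \<in> carrier G \<Longrightarrow> lift G f (free_gen x) = f x"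
  by (simp add: lift_def free_gen_def letter_value_def)

end

lemma hom_eq_on_free_group:
  assumes h: "group_hom (free_group X) G h" and k: "group_hom (free_group X) G k"
    and eq: "\<And>x. x \<in> X \<Longrightarrow> h (free_gen x) = k (free_gen x)"
    and w: "w \<in> carrier (free_group X)"
  shows "h w = k w"
proof -
  interpret h: group_hom "free_group X" G h by (rule h)
  interpret k: group_hom "free_group X" G k by (rule k)
  have letter: "h [p] = k [p]" if "fst p \<in> X" for p
  proof (cases "snd p")
    case True
    then show ?thesis
      using eq[OF that] by (cases p) (simp add: free_gen_def)
  next
    case False
    then have "[p] = inv\<^bsub>free_group X\<^esub> (free_gen (fst p))"
      using that by (cases p) (simp add: free_gen_def inv_letter_word inv_letter_def)
    then show ?thesis
      using eq[OF that] that by (simp add: free_gen_closed)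
  qed
  show ?thesis
    using w
  proof (induction w)
    case Nil
    then show ?case using h.hom_one k.hom_one by simp
  next
    case (Cons p w)
    note * = Cons_carrier_free_group[OF Cons.prems]
    have "h (foldr push [p] w) = h [p] \<otimes>\<^bsub>G\<^esub> h w" "k (foldr push [p] w) = k [p] \<otimes>\<^bsub>G\<^esub> k w"
      using h.hom_mult[of "[p]" w] k.hom_mult[of "[p]" w] * letter_carrier[of p X] by auto
    then show ?case
      using Cons.IH * letter[of p] by simp
  qed
qed

lemma carrier_free_group_generate:
  "carrier (free_group X) = generate (free_group X) (free_gen ` X)"
proof
  interpret group "free_group X" by (rule group_free_group)
  show "generate (free_group X) (free_gen ` X) \<subseteq> carrier (free_group X)"
    by (intro generate_incl) (auto simp: free_gen_closed)
  show "carrier (free_group X) \<subseteq> generate (free_group X) (free_gen ` X)"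
  proof
    fix w assume "w \<in> carrier (free_group X)"
    then show "w \<in> generate (free_group X) (free_gen ` X)"
    proof (induction w)
      case Nil
      then show ?case using generate.one[of "free_group X"] by simp
    next
      case (Cons p w)
      note * = Cons_carrier_free_group[OF Cons.prems]
      have "[p] \<in> generate (free_group X) (free_gen ` X)"
      proof (cases "snd p")
        case True
        then have "[p] = free_gen (fst p)" by (cases p) (simp add: free_gen_def)
        then show ?thesis using * by (auto intro: generate.incl)
      next
        case False
        then have "[p] = inv\<^bsub>free_group X\<^esub> (free_gen (fst p))"
          using * by (cases p) (simp add: free_gen_def inv_letter_word inv_letter_def)
        then show ?thesis using * by (auto intro: generate.inv)
      qed
      then show ?case
        using generate.eng[of "[p]" "free_group X" "free_gen ` X" w] * Cons.IH by simp
    qed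
  qed
qed

lemma finitely_generated_free_group:
  assumes "finite X"
  shows "finitely_generated (free_group X)"
  unfolding finitely_generated_def fin_gen_subgroup_def
proof (intro conjI exI)
  show "finite (free_gen ` X)" "free_gen ` X \<subseteq> carrier (free_group X)"
    using assms by (auto simp: free_gen_closed)
qed (rule group_free_group carrier_free_group_generate)+

lemma countable_free_group:
  assumes "countable X"
  shows "countable (carrier (free_group X))"
proof (rule countable_subset)
  show "countable (lists (X \<times> (UNIV :: bool set)))"
    by (intro countable_lists countable_SIGMA assms countableI_type)
  show "carrier (free_group X) \<subseteq> lists (X \<times> UNIV)"
    by (fastforce simp: free_group_def in_lists_conv_set)
qed


section \<open>Realising an injective endomorphism as a conjugation\<close>

text \<open>
  The permutation that will represent a stable letter. Let \<open>G\<close> act on \<open>\<Omega>\<close>, infinitely many copies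
  of itself, by left translation. Twisting this action by the injective map \<open>\<tau>\<close> gives another free
  action, whose orbits are the sets \<open>B h \<times> {i}\<close> with \<open>B = \<tau>(G)\<close>; both have countably infinitely many
  orbits, so an equivariant bijection \<open>\<theta>\<close> between them exists. The point is to have it preserve the set \<open>P\<close>,
  which fills \<open>H\<close> in the copies tagged \<open>True\<close> and nothing in those tagged \<open>False\<close>. A twisted orbit
  meets \<open>P\<close> either not at all or, since \<open>B \<inter> H = \<tau>(H)\<close>, in \<open>\<tau>(H) r\<close> for some \<open>r \<in> H\<close>. There are
  infinitely many orbits of either kind on both sides, so orbits can be matched with orbits of the
  same kind.
\<close>

lemma (in group) conjugating_permutation:
  assumes countable: "countable (carrier G)"
    and hom: "\<tau> \<in> hom G G" and inj: "inj_on \<tau> (carrier G)"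
    and H: "subgroup H G" and inv_H: "\<And>g. g \<in> carrier G \<Longrightarrow> \<tau> g \<in> H \<longleftrightarrow> g \<in> H"
  defines "\<Omega> \<equiv> carrier G \<times> (UNIV :: (bool \<times> nat) set)"
    and "P \<equiv> H \<times> ({True} \<times> (UNIV :: nat set))"
  shows "\<exists>\<theta>. bij_betw \<theta> \<Omega> \<Omega> \<and> \<theta> ` P = P \<and> (\<forall>g\<in>carrier G. \<forall>h\<in>carrier G. \<forall>i.
    \<theta> (g \<otimes> h, i) = (\<tau> g \<otimes> fst (\<theta> (h, i)), snd (\<theta> (h, i))))"
proof -
  interpret \<tau>: group_hom G G \<tau>
    using hom by unfold_locales
  define B where "B = \<tau> ` carrier G"
  have B: "subgroup B G"
    unfolding B_def by (rule \<tau>.img_is_subgroup)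
  have B_sub: "B \<subseteq> carrier G" using B by (rule subgroup.subset)
  have H_sub: "H \<subseteq> carrier G" using H by (rule subgroup.subset)
  \<comment> \<open>Coset representatives chosen in \<open>H\<close> whenever possible: then \<open>B h \<inter> H = \<tau>(H) rep h\<close> for
    every coset \<open>B h\<close> that meets \<open>H\<close>.\<close>
  define rep where "rep h = (if (B #> h) \<inter> H \<noteq> {} then SOME r. r \<in> (B #> h) \<inter> H else SOME r. r \<in> B #> h)"
    for h
  have rep_in: "rep h \<in> B #> h" if "h \<in> carrier G" for h
  proof (cases "(B #> h) \<inter> H = {}")
    case True
    then show ?thesis
      using someI[of "\<lambda>r. r \<in> B #> h", OF rcos_self[OF that B]] by (simp add: rep_def)
  next
    case False
    then have "(SOME r. r \<in> (B #> h) \<inter> H) \<in> (B #> h) \<inter> H"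
      by (intro some_in_eq[THEN iffD2])
    with False show ?thesis by (simp add: rep_def)
  qed
  have rep_H: "rep h \<in> H" if "h \<in> H" for h
  proof -
    have *: "(B #> h) \<inter> H \<noteq> {}" using rcos_self[of h, OF _ B] that H_sub by auto
    then have "(SOME r. r \<in> (B #> h) \<inter> H) \<in> (B #> h) \<inter> H"
      by (intro some_in_eq[THEN iffD2])
    with * show ?thesis by (simp add: rep_def)
  qed
  have rep_carrier: "rep h \<in> carrier G" if "h \<in> carrier G" for h
    using rep_in[OF that] r_coset_subset_G[OF B_sub that] by auto
  have rep_cong: "rep h = rep k" if "B #> h = B #> k" for h k
    using that by (simp add: rep_def)
  have rep_rep: "rep (\<tau> g \<otimes> rep h) = rep h" if "g \<in> carrier G" "h \<in> carrier G" for g h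
  proof -
    have "\<tau> g \<otimes> rep h \<in> B #> h"
      using that rep_in[OF that(2)] B_sub
      by (auto simp: r_coset_def B_def m_assoc[symmetric] simp flip: \<tau>.hom_mult)
    then have "B #> h = B #> (\<tau> g \<otimes> rep h)"
      using that B by (intro repr_independence)
    then show ?thesis
      using rep_cong by metis
  qed
  have decomp: "\<exists>g\<in>carrier G. \<tau> g \<otimes> rep h = h" if h: "h \<in> carrier G" for h
  proof -
    have "h \<in> B #> rep h"
      using repr_independence[OF rep_in[OF h] h B] rcos_self[OF h B] by simp
    then obtain g where "g \<in> carrier G" "h = \<tau> g \<otimes> rep h"
      unfolding r_coset_def B_def by blast
    then show ?thesis by (intro bexI[of _ g]) (rule sym)
  qed
  define R where "R = rep ` carrier G"
  have R_sub: "R \<subseteq> carrier G" using rep_carrier by (auto simp: R_def)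
  have rep_R: "rep (\<tau> g \<otimes> r) = r" if "g \<in> carrier G" "r \<in> R" for g r
    using that rep_rep by (auto simp: R_def)
  \<comment> \<open>\<open>R \<times> UNIV\<close> labels the twisted orbits; \<open>D True\<close> are the labels of those that meet \<open>P\<close>. The
    bijection \<open>f\<close> matches the copies of \<open>G\<close> tagged \<open>s\<close> with \<open>D s\<close>.\<close>
  define D where "D s = (if s then (R \<inter> H) \<times> ({True} \<times> (UNIV :: nat set))
     else R \<times> UNIV - (R \<inter> H) \<times> ({True} \<times> UNIV))" for s
  have one: "rep \<one> \<in> R \<inter> H"
    using rep_H[of \<one>] H by (auto simp: R_def subgroup.one_closed)
  have "countable (D s)" for s
  proof -
    have "D s \<subseteq> carrier G \<times> UNIV" using R_sub by (auto simp: D_def)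
    then show ?thesis
      using countable by (meson countable_SIGMA countable_subset countableI_type)
  qed
  moreover have "infinite (D s)" for s
  proof -
    have "inj (\<lambda>n::nat. (rep \<one>, (s, n)))" by (auto simp: inj_def)
    moreover have "range (\<lambda>n. (rep \<one>, (s, n))) \<subseteq> D s" using one by (auto simp: D_def)
    ultimately show ?thesis by (meson infinite_UNIV_nat infinite_iff_countable_subset)
  qed
  ultimately have e: "bij_betw (from_nat_into (D s)) UNIV (D s)" for s
    by (intro bij_betw_from_nat_into)
  define f where "f i = from_nat_into (D (fst i)) (snd i)" for i :: "bool \<times> nat"
  have f_D: "f (s, n) \<in> D s" for s n
    using bij_betwE[OF e[of s]] by (auto simp: f_def)
  have f_R: "fst (f i) \<in> R" for i
    using f_D[of "fst i" "snd i"] by (auto simp: D_def split: if_splits)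
  have f_carrier: "fst (f i) \<in> carrier G" for i
    using f_R R_sub by blast
  have f_onto: "\<exists>n. d = f (s, n)" if "d \<in> D s" for d s
    using that bij_betw_imp_surj_on[OF e[of s]] by (auto simp: f_def)
  have f_inj: "i = j" if "f i = f j" for i j
  proof -
    have "f i \<in> D (fst i)" "f j \<in> D (fst j)" using f_D by (metis prod.collapse)+
    then have "fst i = fst j" using that by (auto simp: D_def split: if_splits)
    then show ?thesis
      using that bij_betw_imp_inj_on[OF e[of "fst i"]] by (auto simp: f_def prod_eq_iff inj_on_def)
  qed
  define \<theta> where "\<theta> = (\<lambda>(g, i). (\<tau> g \<otimes> fst (f i), snd (f i)))"
  have eq: "\<theta> (g \<otimes> h, i) = (\<tau> g \<otimes> fst (\<theta> (h, i)), snd (\<theta> (h, i)))"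
    if "g \<in> carrier G" "h \<in> carrier G" for g h i
    using that f_carrier by (simp add: \<theta>_def m_assoc)
  have onto: "\<exists>g n. g \<in> carrier G \<and> \<theta> (g, (s, n)) = (h, j) \<and> \<tau> g \<otimes> rep h = h"
    if h: "h \<in> carrier G" and j: "(rep h, j) \<in> D s" for h j s
  proof -
    obtain n where n: "f (s, n) = (rep h, j)" using f_onto[OF j] by metis
    obtain g where "g \<in> carrier G" "\<tau> g \<otimes> rep h = h" using decomp[OF h] by blast
    with n show ?thesis
      by (intro exI[of _ g] exI[of _ n]) (simp add: \<theta>_def)
  qed
  have "inj_on \<theta> \<Omega>"
  proof (rule inj_onI)
    fix u v assume "u \<in> \<Omega>" "v \<in> \<Omega>" and uv: "\<theta> u = \<theta> v"
    then obtain g i h j where gh: "u = (g, i)" "v = (h, j)" "g \<in> carrier G" "h \<in> carrier G"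
      by (auto simp: \<Omega>_def)
    have 1: "\<tau> g \<otimes> fst (f i) = \<tau> h \<otimes> fst (f j)" "snd (f i) = snd (f j)"
      using uv gh by (auto simp: \<theta>_def)
    then have "fst (f i) = fst (f j)"
      using rep_R[OF gh(3) f_R[of i]] rep_R[OF gh(4) f_R[of j]] by simp
    with 1 have "\<tau> g = \<tau> h"
      using gh f_carrier by simp
    then have "g = h" using inj gh by (simp add: inj_on_eq_iff)
    moreover have "i = j"
      using \<open>fst (f i) = fst (f j)\<close> 1 f_inj[OF prod_eqI] by blast
    ultimately show "u = v" using gh by simp
  qed
  moreover have "\<theta> ` \<Omega> \<subseteq> \<Omega>"
    using f_carrier by (auto simp: \<theta>_def \<Omega>_def)
  moreover have "\<Omega> \<subseteq> \<theta> ` \<Omega>"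
  proof (rule subsetI, unfold split_paired_all)
    fix h s n assume "(h, (s, n)) \<in> \<Omega>"
    then have h: "h \<in> carrier G" by (simp add: \<Omega>_def)
    have "\<exists>s'. (rep h, (s, n)) \<in> D s'"
      using h by (auto simp: D_def R_def)
    with onto[OF h] obtain g s' n' where "g \<in> carrier G" "\<theta> (g, (s', n')) = (h, (s, n))"
      by metis
    then show "(h, (s, n)) \<in> \<theta> ` \<Omega>" 
      by (intro image_eqI[of _ _ "(g, (s', n'))"]) (simp_all add: \<Omega>_def)
  qed
  ultimately have bij: "bij_betw \<theta> \<Omega> \<Omega>" by (auto simp: bij_betw_def)
  have img: "\<theta> ` P = P"
  proof
    show "\<theta> ` P \<subseteq> P"
    proof (rule image_subsetI, unfold split_paired_all)
      fix h s n assume "(h, (s, n)) \<in> P"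
      then have h: "h \<in> H" "s" by (auto simp: P_def)
      then have "f (s, n) \<in> (R \<inter> H) \<times> ({True} \<times> UNIV)"
        using f_D[of s n] by (simp add: D_def)
      moreover have "\<tau> h \<in> H" using h inv_H H_sub by auto
      ultimately show "\<theta> (h, (s, n)) \<in> P"
        using subgroup.m_closed[OF H] by (auto simp: \<theta>_def P_def)
    qed
    show "P \<subseteq> \<theta> ` P"
    proof (rule subsetI, unfold split_paired_all)
      fix h s n assume "(h, (s, n)) \<in> P"
      then have h: "h \<in> H" "s" "h \<in> carrier G" using H_sub by (auto simp: P_def)
      then have "(rep h, (s, n)) \<in> D True" using rep_H by (auto simp: D_def R_def)
      with onto[OF h(3)] obtain g n' where g: "g \<in> carrier G" "\<theta> (g, (True, n')) = (h, (s, n))"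
          "\<tau> g \<otimes> rep h = h"
        by metis
      have "\<tau> g = h \<otimes> inv (rep h)"
        using g h rep_carrier by (metis \<tau>.hom_closed inv_solve_right)
      then have "\<tau> g \<in> H"
        using h rep_H H by (simp add: subgroup.m_closed subgroup.m_inv_closed)
      then have "g \<in> H" using inv_H g by simp
      then show "(h, (s, n)) \<in> \<theta> ` P" using g
        by (intro image_eqI[of _ _ "(g, (True, n'))"]) (simp_all add: P_def)
    qed
  qed
  show ?thesis
    by (intro exI[of _ \<theta>] conjI ballI allI) (rule bij img eq | assumption)+
qed

section \<open>Benign subgroups from injective endomorphisms\<close>

lemma (in group_hom) hom_eq_one_on_normal_closure:
  assumes R: "R \<subseteq> carrier G" and trivial: "\<And>r. r \<in> R \<Longrightarrow> h r = \<one>\<^bsub>H\<^esub>"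
    and u: "u \<in> normal_closure G R"
  shows "h u = \<one>\<^bsub>H\<^esub>"
proof -
  have "(\<Union>r\<in>R. (\<lambda>g. g \<otimes> r \<otimes> inv g) ` carrier G) \<subseteq> kernel G H h"
    using R trivial by (auto simp: kernel_def subset_iff)
  then have "normal_closure G R \<subseteq> kernel G H h"
    unfolding normal_closure_def by (intro G.generate_subgroup_incl subgroup_kernel)
  then show ?thesis
    using u by (auto simp: kernel_def)
qed

lemma BijGroup_mult:
  "p \<in> Bij S \<Longrightarrow> q \<in> Bij S \<Longrightarrow> p \<otimes>\<^bsub>BijGroup S\<^esub> q = compose S p q"
  by (simp add: BijGroup_def)

lemma carrier_BijGroup [simp]: "carrier (BijGroup S) = Bij S"
  by (simp add: BijGroup_def)

lemma subgroup_set_stabilizer: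
  assumes "P \<subseteq> S"
  shows "subgroup {p \<in> Bij S. p ` P = P} (BijGroup S)"
proof -
  interpret group "BijGroup S" by (rule group_BijGroup)
  show ?thesis
  proof
    fix p q assume pq: "p \<in> {p \<in> Bij S. p ` P = P}" "q \<in> {p \<in> Bij S. p ` P = P}"
    have "compose S p q ` P = p ` (q ` P)"
      using assms by (auto simp: compose_def image_image intro!: image_cong)
    then show "p \<otimes>\<^bsub>BijGroup S\<^esub> q \<in> {p \<in> Bij S. p ` P = P}"
      using pq by (simp add: BijGroup_mult compose_Bij)
  next
    have "(\<lambda>x\<in>S. x) ` P = P" using assms by (auto simp: image_iff subset_iff)
    then show "\<one>\<^bsub>BijGroup S\<^esub> \<in> {p \<in> Bij S. p ` P = P}"
      by (simp add: BijGroup_def id_Bij)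
  next
    fix p assume p: "p \<in> {p \<in> Bij S. p ` P = P}"
    have "inj_on p S" using p by (simp add: Bij_def bij_betw_def)
    then have "inv_into S p ` (p ` P) = P" using assms by (intro inv_into_image_cancel)
    then have "inv_into S p ` P = P" using p by simp
    then have "(\<lambda>x\<in>S. inv_into S p x) ` P = P"
      using assms by (auto simp: image_iff subset_iff restrict_def)
    then show "inv\<^bsub>BijGroup S\<^esub> p \<in> {p \<in> Bij S. p ` P = P}"
      using p inv_closed[of p] by (simp add: inv_BijGroup)
  qed auto
qed

lemma (in group) left_translation_hom:
  "(\<lambda>g. \<lambda>(h, i)\<in>carrier G \<times> I. (g \<otimes> h, i)) \<in> hom G (BijGroup (carrier G \<times> I))"
proof (rule homI)
  let ?\<Omega> = "carrier G \<times> I"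
  show closed: "(\<lambda>(h, i)\<in>?\<Omega>. (g \<otimes> h, i)) \<in> carrier (BijGroup ?\<Omega>)" if "g \<in> carrier G" for g
    unfolding carrier_BijGroup Bij_def
  proof (intro IntI CollectI restrict_extensional bij_betwI)
    show "(\<lambda>(h, i)\<in>?\<Omega>. (inv g \<otimes> h, i)) \<in> ?\<Omega> \<rightarrow> ?\<Omega>" using that by auto
  qed (use that in \<open>auto simp: m_assoc[symmetric]\<close>)
  fix g k assume gk: "g \<in> carrier G" "k \<in> carrier G"
  have "(\<lambda>(h, i)\<in>?\<Omega>. (g \<otimes> k \<otimes> h, i))
    = compose ?\<Omega> (\<lambda>(h, i)\<in>?\<Omega>. (g \<otimes> h, i)) (\<lambda>(h, i)\<in>?\<Omega>. (k \<otimes> h, i))"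
    using gk by (intro ext) (auto simp: compose_def m_assoc)
  then show "(\<lambda>(h, i)\<in>?\<Omega>. (g \<otimes> k \<otimes> h, i))
    = (\<lambda>(h, i)\<in>?\<Omega>. (g \<otimes> h, i)) \<otimes>\<^bsub>BijGroup ?\<Omega>\<^esub> (\<lambda>(h, i)\<in>?\<Omega>. (k \<otimes> h, i))"
    using closed gk by (simp add: BijGroup_mult)
qed

lemma (in group) conj_hom: "a \<in> carrier G \<Longrightarrow> (\<lambda>g. a \<otimes> g \<otimes> inv a) \<in> hom G G"
  by (intro homI) (simp_all add: m_assoc inv_solve_left)

text \<open>
  Turns the relator \<open>s g s\<inverse> \<tau>(g)\<inverse>\<close> into the relation \<open>s g = \<tau>(g) s\<close> and back.
\<close>

lemma (in group) commutator_form_eq_one_iff: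
  assumes "a \<in> carrier G" "b \<in> carrier G" "c \<in> carrier G"
  shows "a \<otimes> b \<otimes> inv a \<otimes> inv c = \<one> \<longleftrightarrow> a \<otimes> b = c \<otimes> a"
  using assms by (metis inv_closed inv_equality inv_inv inv_solve_right m_closed r_inv)

text \<open>
  The overgroup \<open>K\<close> is the multiple ascending HNN extension of \<open>F = free_group X\<close>: adjoin stable
  letters \<open>s\<^sub>j\<close> with \<open>s\<^sub>j g s\<^sub>j\<inverse> = \<tau>\<^sub>j(g)\<close>. It is finitely presented, because these relations need
  only be imposed for the letters \<open>g\<close>. The subgroup \<open>L\<close> is generated by \<open>T\<close> and the stable letters;
  it contains \<open>H\<close> by the minimality assumption on \<open>H\<close>.

  Instead of normal forms in HNN extensions, one permutation representation of \<open>K\<close> shows both that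
  \<open>F\<close> embeds and that \<open>F \<inter> L\<close> is no larger than \<open>H\<close>. Let \<open>F\<close> act on \<open>\<Omega>\<close> by left translation and
  \<open>s\<^sub>j\<close> by the permutation from \<open>conjugating_permutation\<close>. The relations hold, and \<open>F\<close> acts
  faithfully. All generators of \<open>L\<close> preserve \<open>P\<close>; so if \<open>g \<in> F \<inter> L\<close>, then \<open>g\<close> sends the point
  \<open>(1, True, 0)\<close> of \<open>P\<close> to the point \<open>(g, True, 0)\<close> of \<open>P\<close>, which says that \<open>g \<in> H\<close>.
\<close>

theorem benign_free_group_by_endomorphisms:
  fixes X :: "'x set" and \<tau> :: "nat \<Rightarrow> 'x word \<Rightarrow> 'x word" and k :: nat
  assumes X: "finite X" and H: "subgroup H (free_group X)"
    and \<tau>: "\<And>j. j < k \<Longrightarrow> \<tau> j \<in> hom (free_group X) (free_group X)"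
    and inj: "\<And>j. j < k \<Longrightarrow> inj_on (\<tau> j) (carrier (free_group X))"
    and inv_H: "\<And>j g. j < k \<Longrightarrow> g \<in> carrier (free_group X) \<Longrightarrow> \<tau> j g \<in> H \<longleftrightarrow> g \<in> H"
    and T: "finite T" "T \<subseteq> H"
    and least: "\<And>U. subgroup U (free_group X) \<Longrightarrow> T \<subseteq> U \<Longrightarrow>
      (\<And>j g. j < k \<Longrightarrow> g \<in> U \<Longrightarrow> \<tau> j g \<in> U) \<Longrightarrow> H \<subseteq> U"
  shows "benign H (free_group X)"
proof -
  define F where "F = free_group X"
  interpret F: group F unfolding F_def by (rule group_free_group)
  have H_F: "subgroup H F" using H by (simp add: F_def)
  then have H_sub: "H \<subseteq> carrier F" by (rule subgroup.subset)
  obtain f :: "'x \<Rightarrow> nat" and n where f: "f ` X = {i. i < n}" "inj_on f X"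
    using finite_imp_inj_to_nat_seg[OF X] by blast
  \<comment> \<open>Generators of \<open>K\<close> are natural numbers: those below \<open>n\<close> stand for the letters in \<open>X\<close>, the
    number \<open>n + j\<close> for the stable letter \<open>s j\<close>.\<close>
  define Y where "Y = {..<n + k}"
  define E where "E = free_group Y"
  interpret E: group E unfolding E_def by (rule group_free_group)
  define \<iota> where "\<iota> = lift E (free_gen \<circ> f)"
  define s :: "nat \<Rightarrow> nat word" where "s j = free_gen (n + j)" for j
  have f_Y: "f x \<in> Y" if "x \<in> X" for x
  proof -
    have "f x \<in> {i. i < n}" using that f(1) by blast
    then show ?thesis by (simp add: Y_def)
  qed
  have gens: "free_gen \<circ> f \<in> X \<rightarrow> carrier E"
    by (simp add: E_def free_gen_closed f_Y)
  interpret \<iota>: group_hom F E \<iota>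
    unfolding F_def \<iota>_def using gens by (rule E.lift_group_hom)
  have \<iota>_gen: "\<iota> (free_gen x) = free_gen (f x)" if "x \<in> X" for x
    using gens that unfolding \<iota>_def by (subst E.lift_free_gen) auto
  have s: "s j \<in> carrier E" if "j < k" for j
    using that by (simp add: E_def s_def Y_def free_gen_closed)
  have \<tau>_hom: "group_hom F F (\<tau> j)" if "j < k" for j
    using \<tau>[OF that] by unfold_locales (simp add: F_def)
  have gen_F: "free_gen x \<in> carrier F" if "x \<in> X" for x
    using that by (simp add: F_def free_gen_closed)
  have \<tau>_F: "\<tau> j g \<in> carrier F" if "j < k" "g \<in> carrier F" for j g
    using group_hom.hom_closed[OF \<tau>_hom] that by blast
  define r where "r j x = s j \<otimes>\<^bsub>E\<^esub> \<iota> (free_gen x) \<otimes>\<^bsub>E\<^esub> inv\<^bsub>E\<^esub> s j \<otimes>\<^bsub>E\<^esub> inv\<^bsub>E\<^esub> \<iota> (\<tau> j (free_gen x))"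
    for j x
  define R where "R = (\<lambda>(j, x). r j x) ` ({..<k} \<times> X)"
  have R_sub: "R \<subseteq> carrier E" using s gen_F \<tau>_F by (auto simp: R_def r_def)
  define N where "N = normal_closure E R"
  have N: "N \<lhd> E" unfolding N_def using R_sub by (rule E.normal_normal_closure)
  interpret N: normal N E by (rule N)
  define K where "K = E Mod N"
  define \<pi> where "\<pi> g = N #>\<^bsub>E\<^esub> g" for g
  interpret K: group K unfolding K_def by (rule N.factorgroup_is_group)
  interpret \<pi>: group_hom E K \<pi>
    using N.r_coset_hom_Mod by unfold_locales (simp add: K_def \<pi>_def[abs_def])
  have "K = presented_group Y R"
    by (simp add: K_def N_def E_def presented_group_def)
  then have K_fp: "finitely_presented K"
    using X R_sub K.group_axioms iso_refl[of K] unfolding finitely_presented_def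
    by (intro conjI exI[of _ Y] exI[of _ R]) (auto simp: Y_def R_def E_def)

  \<comment> \<open>The representation of \<open>K\<close>, as a homomorphism \<open>\<Psi>\<close> on the free group \<open>E\<close> that kills the relators.\<close>
  define \<Omega> where "\<Omega> = carrier F \<times> (UNIV :: (bool \<times> nat) set)"
  define P where "P = H \<times> ({True} \<times> (UNIV :: nat set))"
  define Q where "Q = BijGroup \<Omega>"
  interpret Q: group Q unfolding Q_def by (rule group_BijGroup)
  have P_sub: "P \<subseteq> \<Omega>" using H_sub by (auto simp: P_def \<Omega>_def)
  have "\<exists>\<theta>. bij_betw \<theta> \<Omega> \<Omega> \<and> \<theta> ` P = P \<and> (\<forall>g\<in>carrier F. \<forall>h\<in>carrier F. \<forall>i.
      \<theta> (g \<otimes>\<^bsub>F\<^esub> h, i) = (\<tau> j g \<otimes>\<^bsub>F\<^esub> fst (\<theta> (h, i)), snd (\<theta> (h, i))))" if j: "j < k" for j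
  proof -
    have "countable (carrier F)"
      using X by (simp add: F_def countable_free_group countable_finite)
    then show ?thesis
      unfolding \<Omega>_def P_def using j H \<tau> inj inv_H unfolding F_def
      by (intro group.conjugating_permutation group_free_group) auto
  qed
  then obtain \<theta> where \<theta>: "\<And>j. j < k \<Longrightarrow> bij_betw (\<theta> j) \<Omega> \<Omega>" "\<And>j. j < k \<Longrightarrow> \<theta> j ` P = P"
    and \<theta>_eq: "\<And>j g h i. j < k \<Longrightarrow> g \<in> carrier F \<Longrightarrow> h \<in> carrier F \<Longrightarrow>
      \<theta> j (g \<otimes>\<^bsub>F\<^esub> h, i) = (\<tau> j g \<otimes>\<^bsub>F\<^esub> fst (\<theta> j (h, i)), snd (\<theta> j (h, i)))"
    by metis
  have \<theta>_Bij: "restrict (\<theta> j) \<Omega> \<in> Bij \<Omega>" if "j < k" for j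
    using \<theta>(1)[OF that] by (auto simp: Bij_def cong: bij_betw_cong)
  define transl where "transl g = (\<lambda>(h, i)\<in>\<Omega>. (g \<otimes>\<^bsub>F\<^esub> h, i))" for g
  interpret transl: group_hom F Q transl
    using F.left_translation_hom[of UNIV] by unfold_locales (simp add: Q_def \<Omega>_def transl_def[abs_def])
  define \<psi> where "\<psi> i = (if i < n then transl (free_gen (inv_into X f i)) else restrict (\<theta> (i - n)) \<Omega>)"
    for i
  have \<psi>: "\<psi> \<in> Y \<rightarrow> carrier Q"
  proof
    fix i assume i: "i \<in> Y"
    have "inv_into X f i \<in> X" if "i < n" using f that by (intro inv_into_into) auto
    then show "\<psi> i \<in> carrier Q"
      using i \<theta>_Bij[of "i - n"] transl.hom_closed[OF gen_F] by (auto simp: \<psi>_def Q_def Y_def)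
  qed
  define \<Psi> where "\<Psi> = lift Q \<psi>"
  interpret \<Psi>: group_hom E Q \<Psi>
    unfolding E_def \<Psi>_def using \<psi> by (rule Q.lift_group_hom)
  have \<Psi>_gen: "\<Psi> (free_gen i) = \<psi> i" if "i \<in> Y" for i
    using \<psi> that unfolding \<Psi>_def by (subst Q.lift_free_gen) auto
  have \<Psi>_s: "\<Psi> (s j) = restrict (\<theta> j) \<Omega>" if "j < k" for j
    using that by (simp add: s_def \<Psi>_gen Y_def \<psi>_def)
  have \<Psi>_\<iota>: "\<Psi> (\<iota> g) = transl g" if "g \<in> carrier F" for g
  proof (rule hom_eq_on_free_group[of X Q "\<lambda>g. \<Psi> (\<iota> g)" transl])
    have "\<Psi> \<circ> \<iota> \<in> hom F Q" using \<iota>.homh \<Psi>.homh by (rule hom_compose)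
    then show "group_hom (free_group X) Q (\<lambda>g. \<Psi> (\<iota> g))"
      by (intro group_hom.intro group_hom_axioms.intro group_free_group Q.group_axioms)
        (simp add: F_def comp_def)
    show "group_hom (free_group X) Q transl" using transl.group_hom_axioms by (simp add: F_def)
    fix x assume x: "x \<in> X"
    then show "\<Psi> (\<iota> (free_gen x)) = transl (free_gen x)"
      using f f_Y[OF x] by (auto simp: \<iota>_gen \<Psi>_gen \<psi>_def)
  qed (use that in \<open>simp add: F_def\<close>)
  have relation: "\<Psi> (s j) \<otimes>\<^bsub>Q\<^esub> transl g = transl (\<tau> j g) \<otimes>\<^bsub>Q\<^esub> \<Psi> (s j)" if j: "j < k" and g: "g \<in> carrier F" for j g
  proof -
    have "compose \<Omega> (restrict (\<theta> j) \<Omega>) (transl g) = compose \<Omega> (transl (\<tau> j g)) (restrict (\<theta> j) \<Omega>)"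
    proof
      fix p
      show "compose \<Omega> (restrict (\<theta> j) \<Omega>) (transl g) p = compose \<Omega> (transl (\<tau> j g)) (restrict (\<theta> j) \<Omega>) p"
      proof (cases "p \<in> \<Omega>")
        case True
        then obtain h i where p: "p = (h, i)" "h \<in> carrier F" by (auto simp: \<Omega>_def)
        obtain h' i' where hi: "\<theta> j (h, i) = (h', i')" by (rule prod.exhaust)
        have "\<theta> j p \<in> \<Omega>" using \<theta>(1)[OF j] True by (auto dest: bij_betwE)
        then show ?thesis
          using p g hi \<theta>_eq[OF j g p(2), of i] by (simp add: compose_def transl_def \<Omega>_def)
      qed (simp add: compose_def)
    qed
    moreover have "transl g \<in> Bij \<Omega>" "transl (\<tau> j g) \<in> Bij \<Omega>"
      using transl.hom_closed g \<tau>_F[OF j g] by (auto simp: Q_def)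
    ultimately show ?thesis
      using j \<theta>_Bij[OF j] by (simp add: \<Psi>_s Q_def BijGroup_mult)
  qed
  have "\<Psi> q = \<one>\<^bsub>Q\<^esub>" if q: "q \<in> R" for q
  proof -
    obtain j x where jx: "j < k" "x \<in> X" "q = r j x" using q by (auto simp: R_def)
    have "\<Psi> q = \<Psi> (s j) \<otimes>\<^bsub>Q\<^esub> transl (free_gen x) \<otimes>\<^bsub>Q\<^esub> inv\<^bsub>Q\<^esub> \<Psi> (s j) \<otimes>\<^bsub>Q\<^esub> inv\<^bsub>Q\<^esub> transl (\<tau> j (free_gen x))"
      using jx gen_F \<tau>_F s by (simp add: r_def flip: \<Psi>_\<iota>)
    also have "\<dots> = \<one>\<^bsub>Q\<^esub>"
      using jx gen_F \<tau>_F s relation by (subst Q.commutator_form_eq_one_iff) auto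
    finally show ?thesis .
  qed
  then have \<Psi>_N: "\<Psi> u = \<one>\<^bsub>Q\<^esub>" if "u \<in> N" for u
    using \<Psi>.hom_eq_one_on_normal_closure[OF R_sub] that unfolding N_def by blast
  have \<Psi>_cong: "\<Psi> u = \<Psi> v" if "\<pi> u = \<pi> v" "u \<in> carrier E" "v \<in> carrier E" for u v
  proof -
    have "u \<in> N #>\<^bsub>E\<^esub> v"
      using E.rcos_self[OF that(2) N.subgroup_axioms] that(1) by (simp add: \<pi>_def)
    then obtain w where "w \<in> N" "u = w \<otimes>\<^bsub>E\<^esub> v" by (auto simp: r_coset_def)
    then show ?thesis using \<Psi>_N that N.subset by auto
  qed

  define \<phi> where "\<phi> = \<pi> \<circ> \<iota>"
  interpret \<phi>: group_hom F K \<phi>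
    unfolding \<phi>_def using hom_compose[OF \<iota>.homh \<pi>.homh] by unfold_locales
  have transl_one: "transl g (\<one>\<^bsub>F\<^esub>, (True, 0)) = (g, (True, 0))" if "g \<in> carrier F" for g
    using that by (simp add: transl_def \<Omega>_def)
  have "\<phi> \<in> mon F K"
    unfolding mon_def
  proof (intro CollectI conjI inj_onI)
    fix u v assume uv: "u \<in> carrier F" "v \<in> carrier F" "\<phi> u = \<phi> v"
    then have "transl u = transl v" using \<Psi>_cong[of "\<iota> u" "\<iota> v"] by (simp add: \<phi>_def \<Psi>_\<iota>)
    then show "u = v" using transl_one uv by (metis prod.inject)
  qed (rule \<phi>.homh)
  have conj: "\<pi> (s j) \<otimes>\<^bsub>K\<^esub> \<phi> g \<otimes>\<^bsub>K\<^esub> inv\<^bsub>K\<^esub> \<pi> (s j) = \<phi> (\<tau> j g)" if j: "j < k" and g: "g \<in> carrier F" for j g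
  proof (rule hom_eq_on_free_group[of X K "\<lambda>g. \<pi> (s j) \<otimes>\<^bsub>K\<^esub> \<phi> g \<otimes>\<^bsub>K\<^esub> inv\<^bsub>K\<^esub> \<pi> (s j)" "\<lambda>g. \<phi> (\<tau> j g)"])
    have "(\<lambda>g. \<pi> (s j) \<otimes>\<^bsub>K\<^esub> g \<otimes>\<^bsub>K\<^esub> inv\<^bsub>K\<^esub> \<pi> (s j)) \<circ> \<phi> \<in> hom F K"
      using \<phi>.homh K.conj_hom[OF \<pi>.hom_closed[OF s[OF j]]] by (rule hom_compose)
    then show "group_hom (free_group X) K (\<lambda>g. \<pi> (s j) \<otimes>\<^bsub>K\<^esub> \<phi> g \<otimes>\<^bsub>K\<^esub> inv\<^bsub>K\<^esub> \<pi> (s j))"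
      by (intro group_hom.intro group_hom_axioms.intro group_free_group K.group_axioms)
        (simp add: F_def comp_def)
    have "\<phi> \<circ> \<tau> j \<in> hom F K"
      using group_hom.homh[OF \<tau>_hom[OF j]] \<phi>.homh by (rule hom_compose)
    then show "group_hom (free_group X) K (\<lambda>g. \<phi> (\<tau> j g))"
      by (intro group_hom.intro group_hom_axioms.intro group_free_group K.group_axioms)
        (simp add: F_def comp_def)
    fix x assume x: "x \<in> X"
    note closed = s[OF j] gen_F[OF x] \<tau>_F[OF j gen_F[OF x]]
    have "r j x \<in> N"
      unfolding N_def normal_closure_def
    proof (rule generate.incl, rule UN_I)
      show "r j x \<in> R" using j x by (auto simp: R_def)
      then have "r j x = \<one>\<^bsub>E\<^esub> \<otimes>\<^bsub>E\<^esub> r j x \<otimes>\<^bsub>E\<^esub> inv\<^bsub>E\<^esub> \<one>\<^bsub>E\<^esub>" using R_sub by auto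
      then show "r j x \<in> (\<lambda>g. g \<otimes>\<^bsub>E\<^esub> r j x \<otimes>\<^bsub>E\<^esub> inv\<^bsub>E\<^esub> g) ` carrier E" by blast
    qed
    then have "\<pi> (r j x) = \<one>\<^bsub>K\<^esub>" by (simp add: \<pi>_def K_def FactGroup_def N.rcos_const)
    then have "\<pi> (s j) \<otimes>\<^bsub>K\<^esub> \<phi> (free_gen x) \<otimes>\<^bsub>K\<^esub> inv\<^bsub>K\<^esub> \<pi> (s j) \<otimes>\<^bsub>K\<^esub> inv\<^bsub>K\<^esub> \<phi> (\<tau> j (free_gen x)) = \<one>\<^bsub>K\<^esub>"
      using closed by (simp add: r_def \<phi>_def)
    then show "\<pi> (s j) \<otimes>\<^bsub>K\<^esub> \<phi> (free_gen x) \<otimes>\<^bsub>K\<^esub> inv\<^bsub>K\<^esub> \<pi> (s j) = \<phi> (\<tau> j (free_gen x))"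
      using closed by (simp add: K.commutator_form_eq_one_iff K.inv_solve_right')
  qed (use g in \<open>simp add: F_def\<close>)

  \<comment> \<open>The finitely generated subgroup \<open>L\<close> that cuts out \<open>H\<close>.\<close>
  define W where "W = \<iota> ` T \<union> s ` {..<k}"
  have T_sub: "T \<subseteq> carrier F" using T H_sub by blast
  have W: "W \<subseteq> carrier E" "finite W" using T T_sub s by (auto simp: W_def)
  define L where "L = generate K (\<pi> ` W)"
  have L: "subgroup L K"
    unfolding L_def using W by (intro K.generate_is_subgroup) auto
  have L_fg: "fin_gen_subgroup L K"
    unfolding fin_gen_subgroup_def L_def using W by (intro exI[of _ "\<pi> ` W"]) auto
  have "\<phi> ` carrier F \<inter> L = \<phi> ` H"
  proof
    have "H \<subseteq> {g \<in> carrier F. \<phi> g \<in> L}"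
    proof (rule least)
      show "subgroup {g \<in> carrier F. \<phi> g \<in> L} (free_group X)"
        unfolding F_def[symmetric] using L
        by (intro F.subgroupI) (auto simp: subgroup.m_closed subgroup.m_inv_closed
            subgroup.one_closed intro!: exI[of _ "\<one>\<^bsub>F\<^esub>"])
      show "T \<subseteq> {g \<in> carrier F. \<phi> g \<in> L}"
        using T_sub by (auto simp: L_def W_def \<phi>_def intro!: generate.incl)
      fix j g assume j: "j < k" and g: "g \<in> {g \<in> carrier F. \<phi> g \<in> L}"
      have "\<pi> (s j) \<in> L" using j by (auto simp: L_def W_def intro!: generate.incl)
      then have "\<pi> (s j) \<otimes>\<^bsub>K\<^esub> \<phi> g \<otimes>\<^bsub>K\<^esub> inv\<^bsub>K\<^esub> \<pi> (s j) \<in> L"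
        using g L by (simp add: subgroup.m_closed subgroup.m_inv_closed)
      then have "\<phi> (\<tau> j g) \<in> L" using conj j g by simp
      then show "\<tau> j g \<in> {g \<in> carrier F. \<phi> g \<in> L}" using \<tau>_F j g by auto
    qed
    then show "\<phi> ` H \<subseteq> \<phi> ` carrier F \<inter> L" by blast
    show "\<phi> ` carrier F \<inter> L \<subseteq> \<phi> ` H"
    proof
      fix y assume "y \<in> \<phi> ` carrier F \<inter> L"
      then obtain g where g: "g \<in> carrier F" "y = \<phi> g" "\<phi> g \<in> L" by auto
      have "L = \<pi> ` generate E W" unfolding L_def using W by (simp add: \<pi>.generate_img)
      then obtain l where l: "l \<in> generate E W" "\<phi> g = \<pi> l" using g by auto
      then have "l \<in> carrier E" using E.generate_incl[OF W(1)] by blast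
      then have "transl g = \<Psi> l" using l \<Psi>_cong[of "\<iota> g" l] g by (simp add: \<phi>_def \<Psi>_\<iota>)
      moreover have "\<Psi> l \<in> {p \<in> Bij \<Omega>. p ` P = P}"
      proof -
        have "\<Psi> ` W \<subseteq> {p \<in> Bij \<Omega>. p ` P = P}"
        proof (rule image_subsetI)
          fix w assume "w \<in> W"
          then consider t where "t \<in> T" "w = \<iota> t" | j where "j < k" "w = s j"
            by (auto simp: W_def)
          then have "\<Psi> w \<in> Bij \<Omega> \<and> \<Psi> w ` P = P"
          proof cases
            case 1
            have t: "t \<in> H" "t \<in> carrier F" using 1 T T_sub by auto
            have H_mult: "t \<otimes>\<^bsub>F\<^esub> h \<in> H" "inv\<^bsub>F\<^esub> t \<otimes>\<^bsub>F\<^esub> h \<in> H" if "h \<in> H" for h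
              using t that H_F by (auto simp: subgroup.m_closed subgroup.m_inv_closed)
            have "transl t (h, i) = (t \<otimes>\<^bsub>F\<^esub> h, i)" if "h \<in> H" for h i
              using that H_sub by (auto simp: transl_def \<Omega>_def)
            moreover have "t \<otimes>\<^bsub>F\<^esub> (inv\<^bsub>F\<^esub> t \<otimes>\<^bsub>F\<^esub> h) = h" if "h \<in> H" for h
              using t that H_sub by (simp add: F.m_assoc[symmetric] subset_iff)
            ultimately have "transl t ` P = P"
              using H_mult by (force simp: P_def image_iff)
            then show ?thesis using 1 t transl.hom_closed[OF t(2)] by (simp add: \<Psi>_\<iota> Q_def)
          next
            case 2
            have "restrict (\<theta> j) \<Omega> ` P = \<theta> j ` P" using P_sub by (intro image_cong) auto
            then show ?thesis using 2 \<theta>_Bij \<theta>(2) by (simp add: \<Psi>_s)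
          qed
          then show "\<Psi> w \<in> {p \<in> Bij \<Omega>. p ` P = P}" by simp
        qed
        then have "generate Q (\<Psi> ` W) \<subseteq> {p \<in> Bij \<Omega>. p ` P = P}"
          using subgroup_set_stabilizer[OF P_sub] unfolding Q_def[symmetric]
          by (rule Q.generate_subgroup_incl)
        then show ?thesis using l \<Psi>.generate_img[OF W(1)] by blast
      qed
      ultimately have "transl g ` P = P" by simp
      moreover have "(\<one>\<^bsub>F\<^esub>, (True, 0)) \<in> P"
        using subgroup.one_closed[OF H_F] by (simp add: P_def)
      ultimately have "transl g (\<one>\<^bsub>F\<^esub>, (True, 0)) \<in> P" by (metis imageI)
      then have "g \<in> H" using g transl_one by (simp add: P_def)
      then show "y \<in> \<phi> ` H" using g by simp
    qed
  qed
  moreover have "finitely_generated F" "subgroup H F"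
    using H X by (simp_all add: F_def finitely_generated_free_group)
  ultimately show ?thesis
    using benignI[of F H K \<phi> L] K_fp \<open>\<phi> \<in> mon F K\<close> L_fg unfolding F_def by blast
qed

section \<open>Subgroups generated by conjugates of letters\<close>

definition shift :: "('a, 'm) monoid_scheme \<Rightarrow> 'a \<Rightarrow> 'a \<Rightarrow> int \<Rightarrow> 'a" where
  "shift G c g i = c [^]\<^bsub>G\<^esub> (- i) \<otimes>\<^bsub>G\<^esub> g \<otimes>\<^bsub>G\<^esub> c [^]\<^bsub>G\<^esub> i"

context group
begin

lemma shift_closed: "c \<in> carrier G \<Longrightarrow> g \<in> carrier G \<Longrightarrow> shift G c g i \<in> carrier G"
  by (simp add: shift_def)

lemma shift_0: "g \<in> carrier G \<Longrightarrow> shift G c g 0 = g"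
  by (simp add: shift_def)

lemma shift_shift:
  assumes "c \<in> carrier G" "g \<in> carrier G"
  shows "shift G c (shift G c g i) j = shift G c g (i + j)"
proof -
  have "c [^] (- (i + j)) = c [^] (- j) \<otimes> c [^] (- i)"
    using int_pow_mult[of c "- j" "- i"] assms by (simp add: add.commute)
  then show ?thesis
    using assms by (simp add: shift_def m_assoc int_pow_mult)
qed

lemma shift_square:
  assumes "c \<in> carrier G"
  shows "shift G (c \<otimes> c) g i = shift G c g (2 * i)"
proof -
  have "c \<otimes> c = c [^] (2::int)"
    using int_pow_mult[of c 1 1] assms by simp
  then show ?thesis
    using assms by (simp add: shift_def int_pow_pow)
qed

lemma inv_shift:
  "c \<in> carrier G \<Longrightarrow> g \<in> carrier G \<Longrightarrow> inv (shift G c g i) = shift G c (inv g) i"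
  by (simp add: shift_def inv_mult_group m_assoc int_pow_neg)

end

lemma (in group_hom) hom_shift:
  "c \<in> carrier G \<Longrightarrow> g \<in> carrier G \<Longrightarrow> h (shift G c g i) = shift H (h c) (h g) i"
  by (simp add: shift_def hom_int_pow)

text \<open>
  A reduced word lies in the subgroup generated by the conjugates \<open>z\<^sup>-\<^sup>i x z\<^sup>i\<close> with \<open>(x, i) \<in> S\<close>, where
  \<open>x \<noteq> z\<close>, if and only if reading it with a counter detects no violation: the counter starts at \<open>0\<close>, every letter
  \<open>z\<close> decreases it, every \<open>z\<inverse>\<close> increases it, any other letter \<open>x\<^sup>\<plusminus>\<^sup>1\<close> is met only when the pair of
  \<open>x\<close> and the counter is in \<open>S\<close>, and the counter ends at \<open>0\<close>. Here \<open>i\<close> is the counter at the start.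
\<close>

primrec supported :: "'x \<Rightarrow> ('x \<times> int) set \<Rightarrow> int \<Rightarrow> 'x word \<Rightarrow> bool" where
  "supported z S i [] \<longleftrightarrow> i = 0"
| "supported z S i (p # w) \<longleftrightarrow>
     (if fst p = z then supported z S (if snd p then i - 1 else i + 1) w
      else (fst p, i) \<in> S \<and> supported z S i w)"

text \<open>
  Cancellation only removes conditions. The converse fails: a word with a forbidden subword
  \<open>x x\<inverse>\<close> can reduce to a supported one, so membership has to be tested on reduced words.
\<close>

lemma supported_push: "supported z S i (p # w) \<Longrightarrow> supported z S i (push p w)"
  by (cases w) (auto simp: inv_letter_def split: if_splits)

definition double :: "'x \<Rightarrow> 'x word \<Rightarrow> 'x word" where
  "double z w = concat (map (\<lambda>p. if fst p = z then [p, p] else [p]) w)"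

lemma double_simps [simp]:
  "double z [] = []"
  "double z (p # w) = (if fst p = z then p # p # double z w else p # double z w)"
  by (simp_all add: double_def)

text \<open>
  Doubling the letters \<open>z\<close> doubles the counter at each other letter.
\<close>

lemma supported_double:
  "supported z S (2 * i) (double z w) \<longleftrightarrow> supported z {(v, i). (v, 2 * i) \<in> S} i w"
proof (induction w arbitrary: i)
  case (Cons p w)
  show ?case
    using Cons.IH[of "i - 1"] Cons.IH[of "i + 1"] Cons.IH[of i]
    by (simp add: algebra_simps)
qed simp

text \<open>
  This is why the endomorphism \<open>z \<mapsto> z z\<close> is injective and why it reflects membership, as tested by
  \<open>supported\<close>: it acts on reduced words without any cancellation.
\<close>

lemma reduced_double: "reduced w \<Longrightarrow> reduced (double z w)"
proof (induction w)
  case (Cons p w)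
  moreover have "p \<noteq> inv_letter p" by (cases p) (simp add: inv_letter_def)
  ultimately show ?case
    by (cases w) (auto simp: reduced_Cons)
qed simp

locale free_group_letter =
  fixes X :: "'x set" and z :: 'x and F :: "'x word monoid" and c :: "'x word"
  assumes z: "z \<in> X" and F: "F = free_group X" and c: "c = free_gen z"
begin

sublocale group F
  unfolding F by (rule group_free_group)

lemma gen_closed: "x \<in> X \<Longrightarrow> free_gen x \<in> carrier F"
  by (simp add: F free_gen_closed)

lemma c_closed: "c \<in> carrier F"
  by (simp add: c gen_closed z)

lemma shift_gen_closed: "x \<in> X \<Longrightarrow> shift F c (free_gen x) i \<in> carrier F"
  by (simp add: shift_closed gen_closed c_closed)

definition span :: "('x \<times> int) set \<Rightarrow> 'x word set" where
  "span S = generate F ((\<lambda>(x, i). shift F c (free_gen x) i) ` S)"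

lemma span_gens_closed: "S \<subseteq> X \<times> UNIV \<Longrightarrow> (\<lambda>(x, i). shift F c (free_gen x) i) ` S \<subseteq> carrier F"
  by (auto simp: shift_gen_closed)

lemma subgroup_span: "S \<subseteq> X \<times> UNIV \<Longrightarrow> subgroup (span S) F"
  unfolding span_def by (rule generate_is_subgroup) (rule span_gens_closed)

lemma shift_in_span: "(x, i) \<in> S \<Longrightarrow> shift F c (free_gen x) i \<in> span S"
  unfolding span_def by (force intro: generate.incl)

lemma span_le_subgroup:
  assumes "subgroup U F" "\<And>x i. (x, i) \<in> S \<Longrightarrow> shift F c (free_gen x) i \<in> U"
  shows "span S \<subseteq> U"
  unfolding span_def using assms by (intro generate_subgroup_incl) auto

lemma letter_mult: "[p] \<otimes>\<^bsub>F\<^esub> w = push p w"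
  by (simp add: F)

lemma inv_c: "inv\<^bsub>F\<^esub> c = [(z, False)]"
  using z inv_letter_word[of "(z, True)" X] by (simp add: F c free_gen_def inv_letter_def)

lemma supported_c_pow_mult:
  assumes "w \<in> carrier F" "supported z S (i - k) w"
  shows "supported z S i (c [^]\<^bsub>F\<^esub> (k::int) \<otimes>\<^bsub>F\<^esub> w)"
  using assms
proof (induction k arbitrary: w rule: int_induct[where k = 0])
  case base
  then show ?case by simp
next
  case (step1 k)
  have "supported z S (i - k) (c \<otimes>\<^bsub>F\<^esub> w)"
    unfolding c free_gen_def letter_mult
    using step1.prems by (intro supported_push) (simp add: algebra_simps)
  moreover have "c [^]\<^bsub>F\<^esub> (k + 1) \<otimes>\<^bsub>F\<^esub> w = c [^]\<^bsub>F\<^esub> k \<otimes>\<^bsub>F\<^esub> (c \<otimes>\<^bsub>F\<^esub> w)"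
    using step1.prems c_closed by (simp add: int_pow_mult m_assoc)
  ultimately show ?case
    using step1 c_closed by simp
next
  case (step2 k)
  have "supported z S (i - k) (inv\<^bsub>F\<^esub> c \<otimes>\<^bsub>F\<^esub> w)"
    unfolding inv_c letter_mult
    using step2.prems by (intro supported_push) (simp add: algebra_simps)
  moreover have "c [^]\<^bsub>F\<^esub> (k - 1) \<otimes>\<^bsub>F\<^esub> w = c [^]\<^bsub>F\<^esub> k \<otimes>\<^bsub>F\<^esub> (inv\<^bsub>F\<^esub> c \<otimes>\<^bsub>F\<^esub> w)"
    using step2.prems c_closed by (simp add: int_pow_diff m_assoc)
  ultimately show ?case
    using step2 c_closed by simp
qed

lemma letter_closed: "fst p \<in> X \<Longrightarrow> [p] \<in> carrier F"
  by (simp add: F letter_carrier)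

lemma supported_shift_mult:
  assumes "fst p \<in> X" "fst p \<noteq> z" "(fst p, i) \<in> S" "w \<in> carrier F" "supported z S 0 w"
  shows "supported z S 0 (shift F c [p] i \<otimes>\<^bsub>F\<^esub> w)"
proof -
  have "supported z S i (c [^]\<^bsub>F\<^esub> i \<otimes>\<^bsub>F\<^esub> w)"
    using assms by (intro supported_c_pow_mult) auto
  then have "supported z S i ([p] \<otimes>\<^bsub>F\<^esub> (c [^]\<^bsub>F\<^esub> i \<otimes>\<^bsub>F\<^esub> w))"
    unfolding letter_mult using assms by (intro supported_push) simp
  then have "supported z S 0 (c [^]\<^bsub>F\<^esub> (- i) \<otimes>\<^bsub>F\<^esub> ([p] \<otimes>\<^bsub>F\<^esub> (c [^]\<^bsub>F\<^esub> i \<otimes>\<^bsub>F\<^esub> w)))"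
    using assms c_closed letter_closed by (intro supported_c_pow_mult) auto
  then show ?thesis
    using assms c_closed letter_closed by (simp add: shift_def m_assoc)
qed

lemma shift_letter_in_span:
  assumes "fst p \<in> X" "(fst p, i) \<in> S"
  shows "shift F c [p] i \<in> span S"
proof (cases "snd p")
  case True
  then have "[p] = free_gen (fst p)" by (cases p) (simp add: free_gen_def)
  then show ?thesis using assms shift_in_span by simp
next
  case False
  then have "[p] = inv\<^bsub>F\<^esub> (free_gen (fst p))"
    using assms by (cases p) (simp add: F free_gen_def inv_letter_word inv_letter_def)
  then have "shift F c [p] i = inv\<^bsub>F\<^esub> (shift F c (free_gen (fst p)) i)"
    using assms by (simp add: inv_shift gen_closed c_closed)
  then show ?thesis
    using assms unfolding span_def by (force intro: generate.inv)
qed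

text \<open>
  From left to right, multiplying by a generator keeps a word supported. From right to left, a letter
  \<open>x\<close> read at counter \<open>i\<close> contributes the factor \<open>z\<^sup>-\<^sup>i x z\<^sup>i\<close> to the word.
\<close>

lemma mem_span_iff_supported:
  assumes S: "S \<subseteq> (X - {z}) \<times> UNIV" and w: "w \<in> carrier F"
  shows "w \<in> span S \<longleftrightarrow> supported z S 0 w"
proof
  assume "w \<in> span S"
  then have "\<forall>u\<in>carrier F. supported z S 0 u \<longrightarrow> supported z S 0 (w \<otimes>\<^bsub>F\<^esub> u)"
    unfolding span_def
  proof (induction rule: generate.induct)
    case one
    then show ?case by simp
  next
    case (incl h)
    then obtain x i where "(x, i) \<in> S" "h = shift F c [(x, True)] i"
      by (auto simp: free_gen_def)
    then show ?case
      using S supported_shift_mult[of "(x, True)"] by auto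
  next
    case (inv h)
    then obtain x i where xi: "(x, i) \<in> S" "h = shift F c (free_gen x) i"
      by auto
    moreover have "inv\<^bsub>F\<^esub> (free_gen x) = [(x, False)]"
      using xi S inv_letter_word[of "(x, True)" X] by (auto simp: F free_gen_def inv_letter_def)
    ultimately have "inv\<^bsub>F\<^esub> h = shift F c [(x, False)] i"
      using S by (auto simp: inv_shift gen_closed c_closed)
    then show ?case
      using xi S supported_shift_mult[of "(x, False)"] by auto
  next
    case (eng g h)
    have "generate F ((\<lambda>(x, i). shift F c (free_gen x) i) ` S) \<subseteq> carrier F"
      using S by (intro generate_incl span_gens_closed) auto
    then have "g \<in> carrier F" "h \<in> carrier F" using eng.hyps by auto
    then show ?case using eng.IH by (simp add: m_assoc)
  qed
  moreover have "supported z S 0 \<one>\<^bsub>F\<^esub>" by (simp add: F)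
  ultimately show "supported z S 0 w" using w by (metis one_closed r_one)
next
  have sub: "subgroup (span S) F" using S by (intro subgroup_span) auto
  \<comment> \<open>A suffix that is read from counter \<open>i\<close> on has to be multiplied by \<open>c\<^sup>-\<^sup>i\<close>, the value of the
    letters \<open>z\<close> before it.\<close>
  have "supported z S i w \<Longrightarrow> c [^]\<^bsub>F\<^esub> (- i) \<otimes>\<^bsub>F\<^esub> w \<in> span S" for i
    using w
  proof (induction w arbitrary: i)
    case Nil
    then show ?case using subgroup.one_closed[OF sub] by (simp add: F)
  next
    case (Cons p w)
    have p: "fst p \<in> X" "w \<in> carrier F" "p # w = [p] \<otimes>\<^bsub>F\<^esub> w"
      using Cons_carrier_free_group[of p w X] Cons.prems by (auto simp: F)
    note closed = c_closed letter_closed[OF p(1)] p(2)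
    show ?case
    proof (cases "fst p = z")
      case True
      define e :: int where "e = (if snd p then 1 else - 1)"
      have "c [^]\<^bsub>F\<^esub> e = (if snd p then c else inv\<^bsub>F\<^esub> c)"
        using c_closed by (simp add: e_def int_pow_neg)
      then have "[p] = c [^]\<^bsub>F\<^esub> e"
        using True inv_c by (cases p) (auto simp: c free_gen_def)
      then have "c [^]\<^bsub>F\<^esub> (- i) \<otimes>\<^bsub>F\<^esub> (p # w) = c [^]\<^bsub>F\<^esub> (- i + e) \<otimes>\<^bsub>F\<^esub> w"
        using closed int_pow_mult[of c "- i" e] by (simp add: p(3) m_assoc)
      moreover have "supported z S (i - e) w"
        using Cons.prems True by (simp add: e_def split: if_splits)
      ultimately show ?thesis
        using Cons.IH[OF _ p(2), of "i - e"] by (simp add: algebra_simps)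
    next
      case False
      then have "(fst p, i) \<in> S" "supported z S i w" using Cons.prems by auto
      then have "shift F c [p] i \<otimes>\<^bsub>F\<^esub> (c [^]\<^bsub>F\<^esub> (- i) \<otimes>\<^bsub>F\<^esub> w) \<in> span S"
        by (intro subgroup.m_closed[OF sub shift_letter_in_span[OF p(1)] Cons.IH[OF _ p(2)]])
      also have "shift F c [p] i \<otimes>\<^bsub>F\<^esub> (c [^]\<^bsub>F\<^esub> (- i) \<otimes>\<^bsub>F\<^esub> w) = c [^]\<^bsub>F\<^esub> (- i) \<otimes>\<^bsub>F\<^esub> (p # w)"
      proof -
        have "c [^]\<^bsub>F\<^esub> i \<otimes>\<^bsub>F\<^esub> (c [^]\<^bsub>F\<^esub> (- i) \<otimes>\<^bsub>F\<^esub> w) = w"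
          using closed by (simp add: int_pow_neg m_assoc[symmetric])
        then show ?thesis
          using closed by (simp add: shift_def m_assoc p(3))
      qed
      finally show ?thesis .
    qed
  qed
  from this[of 0] show "supported z S 0 w \<Longrightarrow> w \<in> span S" using w by simp
qed

section \<open>Endomorphisms that square a letter\<close>

definition reindex :: "('x \<Rightarrow> int) \<Rightarrow> 'x word \<Rightarrow> 'x word" where
  "reindex d = lift F (\<lambda>x. if x = z then c else shift F c (free_gen x) (d x))"

text \<open>
  \<open>dilate d\<close> sends the conjugate of \<open>x\<close> with index \<open>i\<close> to the one with index \<open>2 i + d x\<close>. It factors
  into the dilation \<open>i \<mapsto> 2 i\<close>, which is the substitution \<open>double\<close> on reduced words, followed by the
  automorphism \<open>reindex d\<close>, which translates the indices. This separates the combinatorics of words,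
  needed for the first factor only, from cancellations caused by the second.
\<close>

definition dilate :: "('x \<Rightarrow> int) \<Rightarrow> 'x word \<Rightarrow> 'x word" where
  "dilate d = lift F (\<lambda>x. if x = z then c \<otimes>\<^bsub>F\<^esub> c else shift F c (free_gen x) (d x))"

lemma reindex_group_hom: "group_hom F F (reindex d)"
  unfolding reindex_def using lift_group_hom[of _ X]
  by (auto simp: F[symmetric] c_closed shift_gen_closed)

lemma dilate_group_hom: "group_hom F F (dilate d)"
  unfolding dilate_def using lift_group_hom[of _ X]
  by (auto simp: F[symmetric] c_closed shift_gen_closed)

lemma reindex_gen:
  "reindex d c = c"
  "x \<in> X - {z} \<Longrightarrow> reindex d (free_gen x) = shift F c (free_gen x) (d x)"
  unfolding reindex_def by (subst lift_free_gen | simp add: c c_closed[unfolded c] shift_gen_closed[unfolded c])+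

lemma dilate_gen:
  "dilate d c = c \<otimes>\<^bsub>F\<^esub> c"
  "x \<in> X - {z} \<Longrightarrow> dilate d (free_gen x) = shift F c (free_gen x) (d x)"
  unfolding dilate_def by (subst lift_free_gen | simp add: c c_closed[unfolded c] shift_gen_closed[unfolded c])+

lemma reindex_shift:
  "x \<in> X - {z} \<Longrightarrow> reindex d (shift F c (free_gen x) i) = shift F c (free_gen x) (i + d x)"
  using group_hom.hom_shift[OF reindex_group_hom[of d], of c "free_gen x" i]
  by (simp add: reindex_gen c_closed gen_closed shift_shift add.commute)

lemma dilate_shift:
  "x \<in> X - {z} \<Longrightarrow> dilate d (shift F c (free_gen x) i) = shift F c (free_gen x) (2 * i + d x)"
  using group_hom.hom_shift[OF dilate_group_hom[of d], of c "free_gen x" i]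
  by (simp add: dilate_gen c_closed gen_closed shift_gen_closed shift_square shift_shift add.commute)

lemma hom_eqI:
  assumes h: "group_hom F F h" and k: "group_hom F F k"
    and "h c = k c" "\<And>x. x \<in> X - {z} \<Longrightarrow> h (free_gen x) = k (free_gen x)" and g: "g \<in> carrier F"
  shows "h g = k g"
  using hom_eq_on_free_group[of X F h k g] assms by (auto simp: F c)

lemma group_hom_comp: "group_hom F F h \<Longrightarrow> group_hom F F k \<Longrightarrow> group_hom F F (\<lambda>g. h (k g))"
  by (auto simp: group_hom_def group_hom_axioms_def hom_def Pi_iff)

lemma reindex_reindex_minus: "g \<in> carrier F \<Longrightarrow> reindex (\<lambda>x. - d x) (reindex d g) = g"
proof (rule hom_eqI[of "\<lambda>g. reindex (\<lambda>x. - d x) (reindex d g)" "\<lambda>g. g"])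
  show "group_hom F F (\<lambda>g. g)" by unfold_locales (simp add: hom_def)
qed (auto simp: group_hom_comp reindex_group_hom reindex_gen reindex_shift shift_0 gen_closed)

lemma dilate_eq_reindex_dilate_0: "g \<in> carrier F \<Longrightarrow> dilate d g = reindex d (dilate (\<lambda>_. 0) g)"
proof (rule hom_eqI[of _ "\<lambda>g. reindex d (dilate (\<lambda>_. 0) g)"])
  show "dilate d c = reindex d (dilate (\<lambda>_. 0) c)"
    using group_hom.hom_mult[OF reindex_group_hom[of d] c_closed c_closed]
    by (simp add: dilate_gen reindex_gen)
qed (auto simp: group_hom_comp reindex_group_hom dilate_group_hom dilate_gen reindex_gen shift_0 gen_closed)

lemma dilate_0_eq_double:
  assumes "w \<in> carrier F"
  shows "dilate (\<lambda>_. 0) w = double z w"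
  using assms
proof (induction w)
  case Nil
  then show ?case using group_hom.hom_one[OF dilate_group_hom] by (simp add: F)
next
  case (Cons p w)
  have p: "fst p \<in> X" "w \<in> carrier F" "p # w = [p] \<otimes>\<^bsub>F\<^esub> w"
    using Cons_carrier_free_group[of p w X] Cons.prems by (auto simp: F)
  have "dilate (\<lambda>_. 0) [p] = (if fst p = z then [p] \<otimes>\<^bsub>F\<^esub> [p] else [p])"
  proof (cases "snd p")
    case True
    then have "[p] = free_gen (fst p)" by (cases p) (simp add: free_gen_def)
    then show ?thesis
      using p by (auto simp: dilate_gen shift_0 gen_closed simp flip: c)
  next
    case False
    then have *: "[p] = inv\<^bsub>F\<^esub> (free_gen (fst p))"
      using p by (cases p) (simp add: F free_gen_def inv_letter_word inv_letter_def)
    have "dilate (\<lambda>_. 0) (inv\<^bsub>F\<^esub> (free_gen (fst p))) = inv\<^bsub>F\<^esub> (dilate (\<lambda>_. 0) (free_gen (fst p)))"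
      using group_hom.hom_inv[OF dilate_group_hom gen_closed[OF p(1)]] by simp
    then show ?thesis
      using p by (auto simp: * dilate_gen shift_0 gen_closed inv_mult_group c_closed simp flip: c)
  qed
  moreover have "reduced (double z (p # w))"
    using Cons.prems by (intro reduced_double) (simp add: F free_group_def)
  moreover have "dilate (\<lambda>_. 0) (p # w) = dilate (\<lambda>_. 0) [p] \<otimes>\<^bsub>F\<^esub> double z w"
    using p(3) group_hom.hom_mult[OF dilate_group_hom letter_closed[OF p(1)] p(2)] Cons.IH[OF p(2)]
    by simp
  ultimately show ?case
    by (auto simp: F push_eq_Cons reduced_Cons split: if_splits)
qed

lemma inj_dilate: "inj_on (dilate d) (carrier F)"
proof -
  interpret h: group_hom F F "dilate (\<lambda>_. 0)" by (rule dilate_group_hom)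
  have "w = []" if "double z w = []" for w using that by (cases w) (auto split: if_splits)
  then have "inj_on (dilate (\<lambda>_. 0)) (carrier F)"
    unfolding h.inj_on_one_iff by (simp add: dilate_0_eq_double) (simp add: F)
  moreover have "inj_on (reindex d) (carrier F)"
    by (rule inj_on_inverseI) (rule reindex_reindex_minus)
  ultimately show ?thesis
    by (auto simp: inj_on_def dilate_eq_reindex_dilate_0[of _ d])
qed

text \<open>
  The direction from left to right has content: \<open>dilate d\<close> reflects membership. Undo the translation
  by \<open>reindex (- d)\<close>, which moves \<open>S\<close> to \<open>S''\<close>, and then read off from the reduced word \<open>double z g\<close>
  that \<open>g\<close> is supported on the indices whose double is in \<open>S''\<close>.
\<close>

lemma dilate_mem_span_iff:
  assumes S: "S \<subseteq> (X - {z}) \<times> UNIV" and g: "g \<in> carrier F"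
  shows "dilate d g \<in> span S \<longleftrightarrow> g \<in> span {(x, i). (x, 2 * i + d x) \<in> S}"
proof
  let ?S' = "{(x, i). (x, 2 * i + d x) \<in> S}"
  let ?S'' = "(\<lambda>(x, i). (x, i - d x)) ` S"
  interpret h: group_hom F F "dilate d" by (rule dilate_group_hom)
  interpret k: group_hom F F "reindex (\<lambda>x. - d x)" by (rule reindex_group_hom)
  have S': "?S' \<subseteq> (X - {z}) \<times> UNIV" and S'': "?S'' \<subseteq> (X - {z}) \<times> UNIV"
    using S by auto
  {
    assume "g \<in> span ?S'"
    then have "dilate d g \<in> generate F (dilate d ` (\<lambda>(x, i). shift F c (free_gen x) i) ` ?S')"
      unfolding span_def using S' h.generate_img[OF span_gens_closed] by blast
    also have "\<dots> \<subseteq> span S"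
    proof (rule generate_subgroup_incl)
      have "dilate d (shift F c (free_gen x) i) \<in> span S" if "(x, 2 * i + d x) \<in> S" for x i
      proof -
        have "x \<in> X - {z}" using S that by auto
        then show ?thesis using that by (simp add: dilate_shift shift_in_span)
      qed
      then show "dilate d ` (\<lambda>(x, i). shift F c (free_gen x) i) ` ?S' \<subseteq> span S" by auto
      show "subgroup (span S) F" using S by (intro subgroup_span) auto
    qed
    finally show "dilate d g \<in> span S" .
  }
  have reindex_S: "reindex (\<lambda>x. - d x) (shift F c (free_gen x) i) = shift F c (free_gen x) (i - d x)"
    if "(x, i) \<in> S" for x i
    using subsetD[OF S that] by (simp add: reindex_shift)
  assume "dilate d g \<in> span S"
  then have "reindex (\<lambda>x. - d x) (dilate d g)
      \<in> generate F (reindex (\<lambda>x. - d x) ` (\<lambda>(x, i). shift F c (free_gen x) i) ` S)"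
    unfolding span_def using S k.generate_img[OF span_gens_closed] by blast
  also have "reindex (\<lambda>x. - d x) ` (\<lambda>(x, i). shift F c (free_gen x) i) ` S
      = (\<lambda>(x, i). shift F c (free_gen x) i) ` ?S''"
    unfolding image_image by (intro image_cong) (auto simp: reindex_S)
  also have "generate F \<dots> = span ?S''" by (simp add: span_def)
  also have "reindex (\<lambda>x. - d x) (dilate d g) = dilate (\<lambda>_. 0) g"
    using g group_hom.hom_closed[OF dilate_group_hom]
    by (simp add: dilate_eq_reindex_dilate_0[of g d] reindex_reindex_minus)
  finally have "supported z ?S'' (2 * 0) (double z g)"
    using mem_span_iff_supported[OF S'' group_hom.hom_closed[OF dilate_group_hom[of "\<lambda>_. 0"] g]] g
    by (simp add: dilate_0_eq_double)
  then have "supported z {(x, i). (x, 2 * i) \<in> ?S''} 0 g"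
    by (simp only: supported_double)
  moreover have "{(x, i). (x, 2 * i) \<in> ?S''} = ?S'" by (force simp: image_iff)
  ultimately show "g \<in> span ?S'" using mem_span_iff_supported[OF S' g] by simp
qed

end

section \<open>Benignness of half-infinite sets of conjugates\<close>

text \<open>
  The combinatorial form of \<open>benign_free_group_by_endomorphisms\<close> for the endomorphisms \<open>dilate\<close>: its
  assumptions on \<open>H\<close> become conditions on the affine maps \<open>i \<mapsto> 2 i + d x\<close> of the indices.
\<close>

theorem benign_span:
  fixes X :: "'x set" and d :: "nat \<Rightarrow> 'x \<Rightarrow> int"
  assumes "free_group_letter X z F c" and X: "finite X"
    and S: "S \<subseteq> (X - {z}) \<times> UNIV"
    and invariant: "\<And>j x i. j < k \<Longrightarrow> (x, 2 * i + d j x) \<in> S \<longleftrightarrow> (x, i) \<in> S"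
    and S\<^sub>0: "finite S\<^sub>0" "S\<^sub>0 \<subseteq> S"
    and least: "\<And>V. S\<^sub>0 \<subseteq> V \<Longrightarrow> (\<And>j x i. j < k \<Longrightarrow> (x, i) \<in> V \<Longrightarrow> (x, 2 * i + d j x) \<in> V) \<Longrightarrow> S \<subseteq> V"
  shows "benign (generate F ((\<lambda>(x, i). shift F c (free_gen x) i) ` S)) F"
proof -
  interpret free_group_letter X z F c by (rule assms)
  have "benign (span S) (free_group X)"
  proof (rule benign_free_group_by_endomorphisms[where k = k and \<tau> = "\<lambda>j. dilate (d j)"
        and T = "(\<lambda>(x, i). shift F c (free_gen x) i) ` S\<^sub>0"])
    fix j assume j: "j < k"
    show "dilate (d j) \<in> hom (free_group X) (free_group X)"
      using group_hom.homh[OF dilate_group_hom] by (simp add: F)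
    show "inj_on (dilate (d j)) (carrier (free_group X))"
      using inj_dilate by (simp add: F)
    fix g assume "g \<in> carrier (free_group X)"
    moreover have "{(x, i). (x, 2 * i + d j x) \<in> S} = S" using invariant[OF j] by auto
    ultimately show "dilate (d j) g \<in> span S \<longleftrightarrow> g \<in> span S"
      using dilate_mem_span_iff[OF S, of g "d j"] by (simp add: F)
  next
    fix U assume U: "subgroup U (free_group X)" "(\<lambda>(x, i). shift F c (free_gen x) i) ` S\<^sub>0 \<subseteq> U"
      "\<And>j g. j < k \<Longrightarrow> g \<in> U \<Longrightarrow> dilate (d j) g \<in> U"
    have "S \<subseteq> {(x, i). x \<in> X - {z} \<and> shift F c (free_gen x) i \<in> U}"
    proof (rule least)
      show "S\<^sub>0 \<subseteq> {(x, i). x \<in> X - {z} \<and> shift F c (free_gen x) i \<in> U}"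
        using S S\<^sub>0 U(2) by auto
      fix j x i assume "j < k" "(x, i) \<in> {(x, i). x \<in> X - {z} \<and> shift F c (free_gen x) i \<in> U}"
      then show "(x, 2 * i + d j x) \<in> {(x, i). x \<in> X - {z} \<and> shift F c (free_gen x) i \<in> U}"
        using U(3)[of j "shift F c (free_gen x) i"] by (simp add: dilate_shift)
    qed
    then show "span S \<subseteq> U" using U(1) by (intro span_le_subgroup) (auto simp: F)
  next
    show "subgroup (span S) (free_group X)" using subgroup_span[of S] S by (auto simp: F)
    show "(\<lambda>(x, i). shift F c (free_gen x) i) ` S\<^sub>0 \<subseteq> span S"
      using S\<^sub>0 shift_in_span by auto
  qed (use X S\<^sub>0 in auto)
  then show ?thesis unfolding F[symmetric] span_def .
qed

text \<open>
  With \<open>n = i - m\<close> the two maps are \<open>n \<mapsto> 2 n\<close> and \<open>n \<mapsto> 2 n + 1\<close>, so appending binary digits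
  reaches every \<open>n \<ge> 0\<close> from \<open>0\<close>.
\<close>

lemma half_line_induct:
  fixes m :: int and P :: "int \<Rightarrow> bool"
  assumes "P m" and step: "\<And>i. P i \<Longrightarrow> P (2 * i - m) \<and> P (2 * i - m + 1)"
  shows "m \<le> i \<Longrightarrow> P i"
proof (induction "nat (i - m)" arbitrary: i rule: less_induct)
  case less
  show ?case
  proof (cases "i = m")
    case False
    define j where "j = (i + m) div 2"
    have "m \<le> j" "nat (j - m) < nat (i - m)" and i: "i = 2 * j - m \<or> i = 2 * j - m + 1"
      using False less.prems by (auto simp: j_def)
    then have "P j" using less.hyps by blast
    then show ?thesis using i step by auto
  qed (use assms in simp)
qed

text \<open>
  The reflection \<open>i \<mapsto> 2 m - 1 - i\<close> exchanges the two half-lines and the two maps.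
\<close>

lemma half_line_induct_down:
  fixes m :: int and P :: "int \<Rightarrow> bool"
  assumes "P (m - 1)" and step: "\<And>i. P i \<Longrightarrow> P (2 * i - m) \<and> P (2 * i - m + 1)"
    and "i \<le> m - 1"
  shows "P i"
proof -
  have "P (2 * m - 1 - (2 * i - m)) \<and> P (2 * m - 1 - (2 * i - m + 1))" if "P (2 * m - 1 - i)" for i
    using step[OF that] by (simp add: algebra_simps)
  from half_line_induct[of "\<lambda>i. P (2 * m - 1 - i)" m "2 * m - 1 - i", OF _ this]
  show ?thesis using assms by simp
qed

theorem corollary5p4:
  fixes x y z :: 'x
    and F :: "'x word monoid"
    and a b c :: "'x word"
    and bs :: "int \<Rightarrow> 'x word"
    and m :: int
  assumes "distinct [x, y, z]"
    and "F = free_group {x, y, z}"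
    and "a = free_gen x" and "b = free_gen y" and "c = free_gen z"
    and "\<And>i. bs i = c [^]\<^bsub>F\<^esub> (- i) \<otimes>\<^bsub>F\<^esub> b \<otimes>\<^bsub>F\<^esub> c [^]\<^bsub>F\<^esub> i"
  shows "benign (generate F (bs ` {m..})) F
    \<and> benign (generate F (insert a (bs ` {m..}))) F
    \<and> benign (generate F (bs ` {..m - 1})) F
    \<and> benign (generate F (insert a (bs ` {..m - 1}))) F"
proof -
  have letter: "free_group_letter {x, y, z} z F c"
    using assms by unfold_locales auto
  then interpret free_group_letter "{x, y, z}" z F c .
  let ?g = "\<lambda>(v, i). shift F c (free_gen v) i"
  have bs: "?g ` (A \<union> {y} \<times> I) = ?g ` A \<union> bs ` I" for A I
    using assms by (auto simp: shift_def)
  have a: "?g ` {(x, 0)} = {a}"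
    using assms(3) gen_closed[of x] shift_0[of a c] by simp
  \<comment> \<open>\<open>dilate (d j)\<close> fixes \<open>a\<close>, so it leaves the index \<open>0\<close> of \<open>x\<close> alone, and sends \<open>bs i\<close> to
    \<open>bs (2 * i - m + j)\<close>. Both half-lines are their own inverse images under these
    maps; the seed \<open>s\<close> is \<open>m\<close> or \<open>m - 1\<close>.\<close>
  define d :: "nat \<Rightarrow> 'x \<Rightarrow> int" where "d j v = (if v = y then int j - m else 0)" for j v
  have main: "benign (generate F (?g ` (A \<union> {y} \<times> I))) F"
    if A: "A \<subseteq> {(x, 0)}"
      and I: "\<And>j i. j < 2 \<Longrightarrow> 2 * i + (int j - m) \<in> I \<longleftrightarrow> i \<in> I" and s: "s \<in> I"
      and least: "\<And>P. P s \<Longrightarrow> (\<And>i. P i \<Longrightarrow> P (2 * i - m) \<and> P (2 * i - m + 1)) \<Longrightarrow> \<forall>i\<in>I. P i"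
    for A I s
  proof (rule benign_span[OF letter, where d = d and k = 2 and S\<^sub>0 = "insert (y, s) A"])
    show "A \<union> {y} \<times> I \<subseteq> ({x, y, z} - {z}) \<times> UNIV" using A assms by auto
    show "(v, 2 * i + d j v) \<in> A \<union> {y} \<times> I \<longleftrightarrow> (v, i) \<in> A \<union> {y} \<times> I" if "j < 2" for j v i
      using A I[OF that] assms by (auto simp: d_def)
    show "finite (insert (y, s) A)" using A finite_subset by auto
    show "insert (y, s) A \<subseteq> A \<union> {y} \<times> I" using s by auto
    fix V assume V: "insert (y, s) A \<subseteq> V"
      and step: "\<And>j v i. j < 2 \<Longrightarrow> (v, i) \<in> V \<Longrightarrow> (v, 2 * i + d j v) \<in> V"
    have "(y, 2 * i - m) \<in> V \<and> (y, 2 * i - m + 1) \<in> V" if "(y, i) \<in> V" for i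
      using step[of 0, OF _ that] step[of 1, OF _ that] by (simp add: d_def algebra_simps)
    then have "\<forall>i\<in>I. (y, i) \<in> V" using V by (intro least) auto
    then show "A \<union> {y} \<times> I \<subseteq> V" using V by auto
  qed simp
  have up: "benign (generate F (?g ` (A \<union> {y} \<times> {m..}))) F" if "A \<subseteq> {(x, 0)}" for A
    using that by (rule main[where s = m]) (auto intro: half_line_induct)
  have down: "benign (generate F (?g ` (A \<union> {y} \<times> {..m - 1}))) F" if "A \<subseteq> {(x, 0)}" for A
    using that by (rule main[where s = "m - 1"]) (auto intro: half_line_induct_down)
  show ?thesis
    using up[of "{}"] up[of "{(x, 0)}"] down[of "{}"] down[of "{(x, 0)}"] unfolding bs a by simp
qed

end
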